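(* Let $R$ and $S$ be commutative rings, let $\lambda:R\to S$ be a unital ring homomorphism, and let $\sigma:P^{-1}\to P^{0}$ be a homomorphism between projective $R$-modules which is a $2$-term silting complex. Then $\sigma\otimes_R S$ is a $2$-term silting complex in $\mathrm{Mod}\text{-}S$.
   Context: For a ring $R$ and a homomorphism $\sigma:P^{-1}\to P^0$ between projective $R$-modules (not necessarily finitely generated), put $\mathcal{D}_\sigma=\{X\in\mathrm{Mod}\text{-}R\mid \mathrm{Hom}_R(\sigma,X):\mathrm{Hom}_R(P^0,X)\to \mathrm{Hom}_R(P^{-1},X)\text{ is surjective}\}$. For an $R$-module $T$, $\mathrm{Gen}(T)$ is the class of all $R$-modules $M$ for which there is an epimorphism $T^{(I)}\to M$ for some set $I$. The homomorphism $\sigma$ is called a $2$-term silting complex if $\mathcal{D}_\sigma=\mathrm{Gen}(\mathrm{Coker}(\sigma))$. For a ring homomorphism $\lambda:R\to S$, $\sigma\otimes_R S:P^{-1}\otimes_R S\to P^0\otimes_R S$ denotes the induced homomorphism $\sigma\otimes_R 1_S$ of projective $S$-modules. *)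

theory Defs
  imports "HOL-Algebra.Free_Abelian_Groups" "HOL-Algebra.Generated_Groups"
    "HOL-Algebra.Module" "HOL-Algebra.RingHom"
begin

section \<open>Modules over commutative rings\<close>

text \<open>
  Modules are those of \<^theory>\<open>HOL-Algebra.Module\<close>: records over a commutative ring of which
  only the carrier, zero, addition and scalar multiplication are meaningful. The unused fields
  for multiplication and one are left undefined.
\<close>

definition module_of_group :: "('m, 'k) monoid_scheme \<Rightarrow> ('a \<Rightarrow> 'm \<Rightarrow> 'm) \<Rightarrow> ('a, 'm) module"
  where "module_of_group G act =
    \<lparr>carrier = carrier G, mult = (\<lambda>_ _. undefined), one = undefined,
     zero = \<one>\<^bsub>G\<^esub>, add = (\<otimes>\<^bsub>G\<^esub>), smult = act\<rparr>"

text \<open>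
  As for \<^const>\<open>hom\<close>, a homomorphism is only constrained on the carrier, so homomorphisms
  have to be compared on the carrier.
\<close>

definition mod_hom :: "('a, 'k) ring_scheme \<Rightarrow> ('a, 'm) module \<Rightarrow> ('a, 'n) module \<Rightarrow> ('m \<Rightarrow> 'n) set"
  where "mod_hom R M N =
    {f \<in> hom (add_monoid M) (add_monoid N).
       \<forall>r\<in>carrier R. \<forall>x\<in>carrier M. f (r \<odot>\<^bsub>M\<^esub> x) = r \<odot>\<^bsub>N\<^esub> f x}"

definition mod_epi :: "('a, 'k) ring_scheme \<Rightarrow> ('a, 'm) module \<Rightarrow> ('a, 'n) module \<Rightarrow> ('m \<Rightarrow> 'n) set"
  where "mod_epi R M N = {f \<in> mod_hom R M N. f ` carrier M = carrier N}"

text \<open>The quotient of \<open>M\<close> by a submodule \<open>N\<close>; the union is over equal cosets.\<close>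

definition quot_module :: "('a, 'm) module \<Rightarrow> 'm set \<Rightarrow> ('a, 'm set) module"
  where "quot_module M N =
    module_of_group (M A_Mod N) (\<lambda>r C. \<Union>x\<in>C. N +>\<^bsub>M\<^esub> (r \<odot>\<^bsub>M\<^esub> x))"

definition Coker :: "('a, 'p) module \<Rightarrow> ('a, 'q) module \<Rightarrow> ('p \<Rightarrow> 'q) \<Rightarrow> ('a, 'q set) module"
  where "Coker P Q \<sigma> = quot_module Q (\<sigma> ` carrier P)"

text \<open>The direct sum \<open>T\<^sup>(\<^sup>I\<^sup>)\<close> of copies of \<open>T\<close> indexed by \<open>I\<close>.\<close>

definition copower :: "'i set \<Rightarrow> ('a, 'm) module \<Rightarrow> ('a, 'i \<Rightarrow> 'm) module"
  where "copower I T =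
    module_of_group (sum_group I (\<lambda>_. add_monoid T)) (\<lambda>r x. \<lambda>i\<in>I. r \<odot>\<^bsub>T\<^esub> x i)"

text \<open>
  The ring \<open>S\<close> as an \<open>R\<close>-module along \<open>lam\<close> from \<open>R\<close> to \<open>S\<close>.
\<close>

definition ring_module :: "('b, 'l) ring_scheme \<Rightarrow> ('a \<Rightarrow> 'b) \<Rightarrow> ('a, 'b) module"
  where "ring_module S lam =
    module_of_group (add_monoid S) (\<lambda>r s. lam r \<otimes>\<^bsub>S\<^esub> s)"

text \<open>
  A module is projective if it is a direct summand of a free module \<open>R\<^sup>(\<^sup>I\<^sup>)\<close>. Index sets
  \<open>I\<close> of elements of the type of \<open>P\<close> suffice; see \<open>projective_lift\<close> and \<open>projectiveI_lift\<close>
  below for the equivalence with the lifting property against all epimorphisms.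
\<close>

definition projective :: "('a, 'k) ring_scheme \<Rightarrow> ('a, 'p) module \<Rightarrow> bool"
  where "projective R P \<longleftrightarrow> module R P \<and>
    (\<exists>I :: 'p set.
       \<exists>\<iota>\<in>mod_hom R P (copower I (ring_module R (\<lambda>r. r))).
       \<exists>\<pi>\<in>mod_hom R (copower I (ring_module R (\<lambda>r. r))) P.
         \<forall>x\<in>carrier P. \<pi> (\<iota> x) = x)"


section \<open>Base change\<close>

definition tensor_relations ::
    "('a, 'k) ring_scheme \<Rightarrow> ('a, 'm) module \<Rightarrow> ('a, 'n) module \<Rightarrow> ('m \<times> 'n \<Rightarrow>\<^sub>0 int) set"
  where "tensor_relations R M N =
    {frag_of (x \<oplus>\<^bsub>M\<^esub> x', y) - frag_of (x, y) - frag_of (x', y) | x x' y.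
       x \<in> carrier M \<and> x' \<in> carrier M \<and> y \<in> carrier N} \<union>
    {frag_of (x, y \<oplus>\<^bsub>N\<^esub> y') - frag_of (x, y) - frag_of (x, y') | x y y'.
       x \<in> carrier M \<and> y \<in> carrier N \<and> y' \<in> carrier N} \<union>
    {frag_of (r \<odot>\<^bsub>M\<^esub> x, y) - frag_of (x, r \<odot>\<^bsub>N\<^esub> y) | r x y.
       r \<in> carrier R \<and> x \<in> carrier M \<and> y \<in> carrier N}"

definition tensor_kernel ::
    "('a, 'k) ring_scheme \<Rightarrow> ('a, 'm) module \<Rightarrow> ('a, 'n) module \<Rightarrow> ('m \<times> 'n \<Rightarrow>\<^sub>0 int) set"
  where "tensor_kernel R M N =
    generate (free_Abelian_group (carrier M \<times> carrier N)) (tensor_relations R M N)"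

text \<open>
  The tensor product over \<open>R\<close> as an abelian group, written multiplicatively, and the map
  induced between tensor products by two homomorphisms; in \<open>tensor_map\<close> the modules given are
  those of the codomain, and the union is over equal cosets.
\<close>

definition tensor_group ::
    "('a, 'k) ring_scheme \<Rightarrow> ('a, 'm) module \<Rightarrow> ('a, 'n) module \<Rightarrow> ('m \<times> 'n \<Rightarrow>\<^sub>0 int) set monoid"
  where "tensor_group R M N =
    free_Abelian_group (carrier M \<times> carrier N) Mod tensor_kernel R M N"

definition tensor_map ::
    "('a, 'k) ring_scheme \<Rightarrow> ('a, 'm') module \<Rightarrow> ('a, 'n') module \<Rightarrow> ('m \<Rightarrow> 'm') \<Rightarrow> ('n \<Rightarrow> 'n') \<Rightarrow>
     ('m \<times> 'n \<Rightarrow>\<^sub>0 int) set \<Rightarrow> ('m' \<times> 'n' \<Rightarrow>\<^sub>0 int) set"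
  where "tensor_map R M' N' f g C =
    (\<Union>c\<in>C. tensor_kernel R M' N' #>\<^bsub>free_Abelian_group (carrier M' \<times> carrier N')\<^esub>
       frag_extend (\<lambda>(x, y). frag_of (f x, g y)) c)"

text \<open>
  The \<open>S\<close>-module \<open>M \<otimes> S\<close>: here \<open>s\<close> acts as the tensor product of the identity of \<open>M\<close> with
  multiplication by \<open>s\<close>.
\<close>

definition base_change ::
    "('a, 'k) ring_scheme \<Rightarrow> ('b, 'l) ring_scheme \<Rightarrow> ('a \<Rightarrow> 'b) \<Rightarrow> ('a, 'm) module \<Rightarrow>
     ('b, ('m \<times> 'b \<Rightarrow>\<^sub>0 int) set) module"
  where "base_change R S lam M =
    module_of_group (tensor_group R M (ring_module S lam))
      (\<lambda>s. tensor_map R M (ring_module S lam) (\<lambda>x. x) (\<lambda>t. s \<otimes>\<^bsub>S\<^esub> t))"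

text \<open>The map \<open>\<sigma> \<otimes> 1\<close> from \<open>P \<otimes> S\<close> to \<open>Q \<otimes> S\<close>, for \<open>\<sigma>\<close> from \<open>P\<close> to \<open>Q\<close>.\<close>

definition base_change_map ::
    "('a, 'k) ring_scheme \<Rightarrow> ('b, 'l) ring_scheme \<Rightarrow> ('a \<Rightarrow> 'b) \<Rightarrow> ('a, 'q) module \<Rightarrow> ('p \<Rightarrow> 'q) \<Rightarrow>
     ('p \<times> 'b \<Rightarrow>\<^sub>0 int) set \<Rightarrow> ('q \<times> 'b \<Rightarrow>\<^sub>0 int) set"
  where "base_change_map R S lam Q \<sigma> = tensor_map R Q (ring_module S lam) \<sigma> (\<lambda>t. t)"


section \<open>Silting complexes\<close>

text \<open>
  HOL has no class of all \<open>R\<close>-modules. The category of \<open>R\<close>-modules is rendered by the \<open>R\<close>-modules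
  whose carrier is a subset of a type \<open>'x\<close>. Both classes below are polymorphic in \<open>'x\<close>, the
  type \<open>'x\<close> being arbitrary and unrelated to those of the ring and of \<open>P\<close>, \<open>Q\<close>, \<open>T\<close>.
\<close>

definition silting_class ::
    "('a, 'k) ring_scheme \<Rightarrow> ('a, 'p) module \<Rightarrow> ('a, 'q) module \<Rightarrow> ('p \<Rightarrow> 'q) \<Rightarrow> ('a, 'x) module set"
  where "silting_class R P Q \<sigma> =
    {X. module R X \<and>
        (\<forall>g\<in>mod_hom R P X. \<exists>h\<in>mod_hom R Q X. \<forall>x\<in>carrier P. h (\<sigma> x) = g x)}"

text \<open>
  Since an epimorphism from \<open>T\<^sup>(\<^sup>J\<^sup>)\<close> onto \<open>M\<close> amounts to a family of homomorphisms from \<open>T\<close> to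
  \<open>M\<close>, of which repetitions can be dropped, index sets consisting of functions from \<open>T\<close> to \<open>M\<close>
  are as good as arbitrary ones; this is \<open>GenI\<close> below.
\<close>

definition Gen :: "('a, 'k) ring_scheme \<Rightarrow> ('a, 't) module \<Rightarrow> ('a, 'x) module set"
  where "Gen R T = {M. module R M \<and> (\<exists>I :: ('t \<Rightarrow> 'x) set. mod_epi R (copower I T) M \<noteq> {})}"

definition two_term_silting ::
    "'x itself \<Rightarrow> ('a, 'k) ring_scheme \<Rightarrow> ('a, 'p) module \<Rightarrow> ('a, 'q) module \<Rightarrow> ('p \<Rightarrow> 'q) \<Rightarrow> bool"
  where "two_term_silting (_ :: 'x itself) R P Q \<sigma> \<longleftrightarrow>
    projective R P \<and> projective R Q \<and> \<sigma> \<in> mod_hom R P Q \<and>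
    (silting_class R P Q \<sigma> :: ('a, 'x) module set) = Gen R (Coker P Q \<sigma>)"


section \<open>The restricted index types lose nothing\<close>

lemma module_of_group_simps [simp]:
  "carrier (module_of_group G act) = carrier G"
  "\<zero>\<^bsub>module_of_group G act\<^esub> = \<one>\<^bsub>G\<^esub>"
  "add (module_of_group G act) = (\<otimes>\<^bsub>G\<^esub>)"
  "smult (module_of_group G act) = act"
  by (simp_all add: module_of_group_def)

lemma mod_hom_closed: "f \<in> mod_hom R M N \<Longrightarrow> x \<in> carrier M \<Longrightarrow> f x \<in> carrier N"
  by (auto simp: mod_hom_def hom_def)

lemma mod_hom_add:
  "f \<in> mod_hom R M N \<Longrightarrow> x \<in> carrier M \<Longrightarrow> y \<in> carrier M \<Longrightarrow> f (x \<oplus>\<^bsub>M\<^esub> y) = f x \<oplus>\<^bsub>N\<^esub> f y"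
  by (auto simp: mod_hom_def hom_def)

lemma mod_hom_smult:
  "f \<in> mod_hom R M N \<Longrightarrow> r \<in> carrier R \<Longrightarrow> x \<in> carrier M \<Longrightarrow> f (r \<odot>\<^bsub>M\<^esub> x) = r \<odot>\<^bsub>N\<^esub> f x"
  by (auto simp: mod_hom_def)

lemma mod_homI:
  assumes "\<And>x. x \<in> carrier M \<Longrightarrow> f x \<in> carrier N"
    and "\<And>x y. x \<in> carrier M \<Longrightarrow> y \<in> carrier M \<Longrightarrow> f (x \<oplus>\<^bsub>M\<^esub> y) = f x \<oplus>\<^bsub>N\<^esub> f y"
    and "\<And>r x. r \<in> carrier R \<Longrightarrow> x \<in> carrier M \<Longrightarrow> f (r \<odot>\<^bsub>M\<^esub> x) = r \<odot>\<^bsub>N\<^esub> f x"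
  shows "f \<in> mod_hom R M N"
  using assms by (auto simp: mod_hom_def hom_def)

lemma mod_hom_zero:
  assumes "module R M" "module R N" "f \<in> mod_hom R M N"
  shows "f \<zero>\<^bsub>M\<^esub> = \<zero>\<^bsub>N\<^esub>"
proof -
  interpret M: module R M by fact
  interpret N: module R N by fact
  have "f \<zero>\<^bsub>M\<^esub> = f (\<zero>\<^bsub>R\<^esub> \<odot>\<^bsub>M\<^esub> \<zero>\<^bsub>M\<^esub>)" by simp
  also have "\<dots> = \<zero>\<^bsub>R\<^esub> \<odot>\<^bsub>N\<^esub> f \<zero>\<^bsub>M\<^esub>" using assms(3) by (intro mod_hom_smult) auto
  also have "\<dots> = \<zero>\<^bsub>N\<^esub>" using mod_hom_closed[OF assms(3)] by simp
  finally show ?thesis .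
qed

lemma mod_hom_comp:
  "f \<in> mod_hom R L M \<Longrightarrow> g \<in> mod_hom R M N \<Longrightarrow> (\<lambda>x. g (f x)) \<in> mod_hom R L N"
  by (intro mod_homI) (simp_all add: mod_hom_closed mod_hom_add mod_hom_smult)

lemma ring_module_simps:
  "carrier (ring_module S lam) = carrier S"
  "\<zero>\<^bsub>ring_module S lam\<^esub> = \<zero>\<^bsub>S\<^esub>"
  "add (ring_module S lam) = add S"
  "r \<odot>\<^bsub>ring_module S lam\<^esub> s = lam r \<otimes>\<^bsub>S\<^esub> s"
  by (simp_all add: ring_module_def)

lemma ring_module_module:
  assumes "cring R" "cring S" "lam \<in> ring_hom R S"
  shows "module R (ring_module S lam)"
proof -
  interpret R: cring R by fact
  interpret S: cring S by fact
  interpret ring_hom_cring R S lam by unfold_locales fact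
  have "abelian_group (ring_module S lam)"
    by (rule comm_group_abelian_groupI, rule group.group_comm_groupI)
       (use S.add.is_group in \<open>auto simp: ring_module_def module_of_group_def S.a_comm
          group_def monoid_def group_axioms_def Units_def\<close>)
  then show ?thesis
    by (intro moduleI)
       (auto simp: ring_module_def R.is_cring S.l_distr S.r_distr S.m_assoc)
qed

context
  fixes R :: "('a, 'k) ring_scheme" and T :: "('a, 't) module"
  assumes T: "module R T"
begin

interpretation T: module R T by (rule T)

lemma carrier_copower:
  "carrier (copower I T) = {x \<in> I \<rightarrow>\<^sub>E carrier T. finite {i \<in> I. x i \<noteq> \<zero>\<^bsub>T\<^esub>}}"
  unfolding copower_def using T.add.is_group by (simp add: carrier_sum_group)

lemma copower_simps:
  "\<zero>\<^bsub>copower I T\<^esub> = (\<lambda>i\<in>I. \<zero>\<^bsub>T\<^esub>)"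
  "x \<oplus>\<^bsub>copower I T\<^esub> y = (\<lambda>i\<in>I. x i \<oplus>\<^bsub>T\<^esub> y i)"
  "r \<odot>\<^bsub>copower I T\<^esub> x = (\<lambda>i\<in>I. r \<odot>\<^bsub>T\<^esub> x i)"
  by (simp_all add: copower_def)

lemma copower_module: "module R (copower I T)"
proof (rule moduleI)
  show "cring R" by (rule T.is_cring)
  have g: "group (sum_group I (\<lambda>_. add_monoid T))"
    using T.add.is_group by simp
  have "group (add_monoid (copower I T))"
    unfolding copower_def using g by (simp add: module_of_group_def group_def monoid_def group_axioms_def Units_def)
  moreover have "x \<oplus>\<^bsub>copower I T\<^esub> y = y \<oplus>\<^bsub>copower I T\<^esub> x"
    if "x \<in> carrier (copower I T)" "y \<in> carrier (copower I T)" for x y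
    using that by (auto simp: carrier_copower copower_simps PiE_iff T.M.a_comm intro!: restrict_ext)
  ultimately show "abelian_group (copower I T)"
    by (intro comm_group_abelian_groupI group.group_comm_groupI) auto
next
  fix a x assume "a \<in> carrier R" "x \<in> carrier (copower I T)"
  then show "a \<odot>\<^bsub>copower I T\<^esub> x \<in> carrier (copower I T)"
    by (auto simp: carrier_copower copower_simps PiE_iff elim!: rev_finite_subset)
qed (auto simp: carrier_copower copower_simps PiE_iff T.smult_l_distr T.smult_r_distr
      T.smult_assoc1 extensional_def intro!: restrict_ext)

lemma copower_single_closed:
  assumes "i \<in> I" "t \<in> carrier T"
  shows "(\<lambda>j\<in>I. if j = i then t else \<zero>\<^bsub>T\<^esub>) \<in> carrier (copower I T)"
  using assms by (auto simp: carrier_copower intro: finite_subset[of _ "{i}"])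

lemma copower_induct [consumes 1, case_names zero add]:
  assumes x: "x \<in> carrier (copower I T)"
    and zero: "A \<zero>\<^bsub>copower I T\<^esub>"
    and add: "\<And>i t y. i \<in> I \<Longrightarrow> t \<in> carrier T \<Longrightarrow> y \<in> carrier (copower I T) \<Longrightarrow> A y \<Longrightarrow>
      A ((\<lambda>j\<in>I. if j = i then t else \<zero>\<^bsub>T\<^esub>) \<oplus>\<^bsub>copower I T\<^esub> y)"
  shows "A x"
proof -
  have "finite F \<Longrightarrow> x \<in> carrier (copower I T) \<Longrightarrow> {i \<in> I. x i \<noteq> \<zero>\<^bsub>T\<^esub>} = F \<Longrightarrow> A x" for F x
  proof (induction F arbitrary: x rule: finite_induct)
    case empty
    then have "x = \<zero>\<^bsub>copower I T\<^esub>"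
      by (auto simp: copower_simps carrier_copower PiE_iff extensional_def fun_eq_iff)
    with zero show ?case by simp
  next
    case (insert i F)
    let ?y = "x (i := \<zero>\<^bsub>T\<^esub>)"
    have i: "i \<in> I" using insert.prems(2) by blast
    have supp: "{j \<in> I. ?y j \<noteq> \<zero>\<^bsub>T\<^esub>} = F" using insert.prems(2) insert.hyps(2) by auto
    have y: "?y \<in> carrier (copower I T)"
      using insert.prems(1) i supp insert.hyps(1)
      by (auto simp: carrier_copower PiE_iff extensional_def)
    have "x = (\<lambda>j\<in>I. if j = i then x i else \<zero>\<^bsub>T\<^esub>) \<oplus>\<^bsub>copower I T\<^esub> ?y"
      using insert.prems(1) i
      by (auto simp: carrier_copower copower_simps PiE_iff extensional_def fun_eq_iff)
    moreover have "x i \<in> carrier T" using insert.prems(1) i by (auto simp: carrier_copower)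
    ultimately show ?case using add[OF i _ y insert.IH[OF y supp]] by metis
  qed
  with x show ?thesis by (auto simp: carrier_copower)
qed

lemma copower_single_hom:
  assumes "i \<in> I"
  shows "(\<lambda>t. \<lambda>j\<in>I. if j = i then t else \<zero>\<^bsub>T\<^esub>) \<in> mod_hom R T (copower I T)"
  using assms by (intro mod_homI copower_single_closed) (auto simp: copower_simps fun_eq_iff)

lemma GenI:
  fixes M :: "('a, 'x) module" and J :: "'j set"
  assumes M: "module R M" and f: "f \<in> mod_epi R (copower J T) M"
  shows "M \<in> Gen R T"
proof -
  interpret M: module R M by (rule M)
  have fh: "f \<in> mod_hom R (copower J T) M" and fs: "f ` carrier (copower J T) = carrier M"
    using f by (auto simp: mod_epi_def)
  let ?s = "\<lambda>j t. (\<lambda>k\<in>J. if k = j then t else \<zero>\<^bsub>T\<^esub>)"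
  define \<phi> where "\<phi> j = (\<lambda>t. f (?s j t))" for j
  define I where "I = \<phi> ` J"
  define c where "c = inv_into J \<phi>"
  have c: "c i \<in> J" "\<phi> (c i) = i" if "i \<in> I" for i
    using that by (auto simp: I_def c_def inv_into_into f_inv_into_f)
  define e where "e x = (\<lambda>j\<in>J. if \<phi> j \<in> I \<and> c (\<phi> j) = j then x (\<phi> j) else \<zero>\<^bsub>T\<^esub>)" for x
  have eh: "e \<in> mod_hom R (copower I T) (copower J T)"
  proof (rule mod_homI)
    fix x assume x: "x \<in> carrier (copower I T)"
    have "{j \<in> J. e x j \<noteq> \<zero>\<^bsub>T\<^esub>} \<subseteq> c ` {i \<in> I. x i \<noteq> \<zero>\<^bsub>T\<^esub>}"
    proof
      fix j assume "j \<in> {j \<in> J. e x j \<noteq> \<zero>\<^bsub>T\<^esub>}"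
      then have "\<phi> j \<in> I" "c (\<phi> j) = j" "x (\<phi> j) \<noteq> \<zero>\<^bsub>T\<^esub>" by (auto simp: e_def split: if_splits)
      then show "j \<in> c ` {i \<in> I. x i \<noteq> \<zero>\<^bsub>T\<^esub>}" by (metis (mono_tags, lifting) image_eqI mem_Collect_eq)
    qed
    moreover have "finite {i \<in> I. x i \<noteq> \<zero>\<^bsub>T\<^esub>}" using x by (auto simp: carrier_copower)
    ultimately have "finite {j \<in> J. e x j \<noteq> \<zero>\<^bsub>T\<^esub>}" by (meson finite_imageI finite_subset)
    then show "e x \<in> carrier (copower J T)"
      using x by (auto simp: carrier_copower e_def PiE_iff)
  qed (auto simp: e_def copower_simps carrier_copower PiE_iff fun_eq_iff)
  have fe: "(\<lambda>x. f (e x)) \<in> mod_hom R (copower I T) M"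
    by (rule mod_hom_comp[OF eh fh])
  have "\<exists>x\<in>carrier (copower I T). f (e x) = f y" if "y \<in> carrier (copower J T)" for y
    using that
  proof (induction rule: copower_induct)
    case zero
    interpret CI: module R "copower I T" by (rule copower_module)
    show ?case
      using mod_hom_zero[OF copower_module M fe] mod_hom_zero[OF copower_module M fh]
      by (intro bexI[of _ "\<zero>\<^bsub>copower I T\<^esub>"]) auto
  next
    case (add j t y)
    interpret CI: module R "copower I T" by (rule copower_module)
    from add.IH obtain x where x: "x \<in> carrier (copower I T)" "f (e x) = f y" by blast
    let ?u = "\<lambda>i\<in>I. if i = \<phi> j then t else \<zero>\<^bsub>T\<^esub>"
    have jI: "\<phi> j \<in> I" using add.hyps by (auto simp: I_def)
    have u: "?u \<in> carrier (copower I T)" by (rule copower_single_closed) (use jI add.hyps in auto)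
    have "e ?u = ?s (c (\<phi> j)) t"
    proof
      fix k show "e ?u k = ?s (c (\<phi> j)) t k"
        using jI c[OF jI] by (auto simp: e_def)
    qed
    then have "f (e ?u) = \<phi> (c (\<phi> j)) t" by (simp add: \<phi>_def)
    also have "\<dots> = f (?s j t)" using c(2)[OF jI] by (simp add: \<phi>_def)
    finally have "f (e (?u \<oplus>\<^bsub>copower I T\<^esub> x)) = f (?s j t \<oplus>\<^bsub>copower J T\<^esub> y)"
      using mod_hom_add[OF fe u x(1)] x(2)
        mod_hom_add[OF fh copower_single_closed[OF add.hyps(1,2)] add.hyps(3)] by simp
    then show ?case using u x(1) by (intro bexI[of _ "?u \<oplus>\<^bsub>copower I T\<^esub> x"]) auto
  qed
  then have "carrier M \<subseteq> (\<lambda>x. f (e x)) ` carrier (copower I T)"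
    using fs by (force simp: image_iff)
  with fe have "(\<lambda>x. f (e x)) \<in> mod_epi R (copower I T) M"
    by (auto simp: mod_epi_def mod_hom_closed[OF fe])
  with M show ?thesis unfolding Gen_def by blast
qed

end

lemma free_module_hom:
  fixes M :: "('a, 'm) module" and m :: "'i \<Rightarrow> 'm"
  assumes M: "module R M" and m: "m \<in> I \<rightarrow> carrier M"
  shows "\<exists>h\<in>mod_hom R (copower I (ring_module R (\<lambda>r. r))) M.
    \<forall>i\<in>I. h (\<lambda>j\<in>I. if j = i then \<one>\<^bsub>R\<^esub> else \<zero>\<^bsub>R\<^esub>) = m i"
proof -
  interpret M: module R M by (rule M)
  let ?R = "ring_module R (\<lambda>r. r)"
  have RR: "module R ?R"
    by (rule ring_module_module) (auto intro: ring_hom_memI M.is_cring)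
  note ring_module_simps [simp]
  define S where "S x = {i \<in> I. x i \<noteq> \<zero>\<^bsub>R\<^esub>}" for x :: "'i \<Rightarrow> 'a"
  define h where "h x = (\<Oplus>\<^bsub>M\<^esub>i\<in>S x. x i \<odot>\<^bsub>M\<^esub> m i)" for x
  have fin: "finite (S x)" "x i \<in> carrier R" if "x \<in> carrier (copower I ?R)" "i \<in> I" for x i
    using that by (auto simp: carrier_copower[OF RR] S_def)
  have hF: "h x = (\<Oplus>\<^bsub>M\<^esub>i\<in>F. x i \<odot>\<^bsub>M\<^esub> m i)"
    if "x \<in> carrier (copower I ?R)" "finite F" "S x \<subseteq> F" "F \<subseteq> I" for x F
    unfolding h_def using that m
    by (intro M.add.finprod_mono_neutral_cong_left)
       (auto simp: carrier_copower[OF RR] S_def PiE_iff subset_iff Pi_iff)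
  have hom: "h \<in> mod_hom R (copower I ?R) M"
  proof (rule mod_homI)
    fix x assume x: "x \<in> carrier (copower I ?R)"
    show "h x \<in> carrier M" unfolding h_def
      using x m by (intro M.M.finsum_closed) (auto simp: carrier_copower[OF RR] S_def PiE_iff)
  next
    fix x y assume xy: "x \<in> carrier (copower I ?R)" "y \<in> carrier (copower I ?R)"
    interpret C: module R "copower I ?R" by (rule copower_module[OF RR])
    let ?F = "S x \<union> S y"
    have F: "finite ?F" "?F \<subseteq> I" using xy by (auto simp: carrier_copower[OF RR] S_def)
    have s: "S (x \<oplus>\<^bsub>copower I ?R\<^esub> y) \<subseteq> ?F"
      by (auto simp: S_def copower_simps[OF RR])
    have "h (x \<oplus>\<^bsub>copower I ?R\<^esub> y) = (\<Oplus>\<^bsub>M\<^esub>i\<in>?F. (x \<oplus>\<^bsub>copower I ?R\<^esub> y) i \<odot>\<^bsub>M\<^esub> m i)"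
      using xy F s by (intro hF) auto
    also have "\<dots> = (\<Oplus>\<^bsub>M\<^esub>i\<in>?F. x i \<odot>\<^bsub>M\<^esub> m i \<oplus>\<^bsub>M\<^esub> y i \<odot>\<^bsub>M\<^esub> m i)"
      using xy F(2) m
      by (intro M.M.finsum_cong')
         (auto simp: copower_simps[OF RR] carrier_copower[OF RR] PiE_iff subset_iff Pi_iff M.smult_l_distr)
    also have "\<dots> = (\<Oplus>\<^bsub>M\<^esub>i\<in>?F. x i \<odot>\<^bsub>M\<^esub> m i) \<oplus>\<^bsub>M\<^esub> (\<Oplus>\<^bsub>M\<^esub>i\<in>?F. y i \<odot>\<^bsub>M\<^esub> m i)"
      using xy F(2) m
      by (intro M.M.finsum_addf) (auto simp: carrier_copower[OF RR] PiE_iff subset_iff Pi_iff)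
    also have "\<dots> = h x \<oplus>\<^bsub>M\<^esub> h y"
      using hF[OF xy(1) F(1) _ F(2)] hF[OF xy(2) F(1) _ F(2)] by simp
    finally show "h (x \<oplus>\<^bsub>copower I ?R\<^esub> y) = h x \<oplus>\<^bsub>M\<^esub> h y" .
  next
    fix r x assume r: "r \<in> carrier R" and x: "x \<in> carrier (copower I ?R)"
    interpret C: module R "copower I ?R" by (rule copower_module[OF RR])
    have F: "finite (S x)" "S x \<subseteq> I" using x by (auto simp: carrier_copower[OF RR] S_def)
    have s: "S (r \<odot>\<^bsub>copower I ?R\<^esub> x) \<subseteq> S x"
      using r by (auto simp: S_def copower_simps[OF RR])
    have "h (r \<odot>\<^bsub>copower I ?R\<^esub> x) = (\<Oplus>\<^bsub>M\<^esub>i\<in>S x. (r \<odot>\<^bsub>copower I ?R\<^esub> x) i \<odot>\<^bsub>M\<^esub> m i)"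
      using r x F s by (intro hF) auto
    also have "\<dots> = (\<Oplus>\<^bsub>M\<^esub>i\<in>S x. r \<odot>\<^bsub>M\<^esub> (x i \<odot>\<^bsub>M\<^esub> m i))"
      using r x F(2) m
      by (intro M.M.finsum_cong')
         (auto simp: copower_simps[OF RR] carrier_copower[OF RR] PiE_iff subset_iff Pi_iff M.smult_assoc1)
    also have "\<dots> = r \<odot>\<^bsub>M\<^esub> h x"
      unfolding h_def using r x F m
      by (intro M.finsum_smult_ldistr[symmetric])
         (auto simp: carrier_copower[OF RR] PiE_iff subset_iff Pi_iff)
    finally show "h (r \<odot>\<^bsub>copower I ?R\<^esub> x) = r \<odot>\<^bsub>M\<^esub> h x" .
  qed
  moreover have "h (\<lambda>j\<in>I. if j = i then \<one>\<^bsub>R\<^esub> else \<zero>\<^bsub>R\<^esub>) = m i" if i: "i \<in> I" for i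
  proof -
    let ?u = "\<lambda>j\<in>I. if j = i then \<one>\<^bsub>R\<^esub> else \<zero>\<^bsub>R\<^esub>"
    have u: "?u \<in> carrier (copower I ?R)"
      using copower_single_closed[OF RR i, of "\<one>\<^bsub>R\<^esub>"]
    unfolding ring_module_simps by simp
    have mi: "m i \<in> carrier M" using i m by auto
    have "h ?u = (\<Oplus>\<^bsub>M\<^esub>k\<in>{i}. ?u k \<odot>\<^bsub>M\<^esub> m k)"
      using u i by (intro hF) (auto simp: S_def)
    also have "\<dots> = m i" using i mi by (subst M.M.finsum_insert) auto
    finally show ?thesis .
  qed
  ultimately show ?thesis by (intro bexI[of _ h] ballI)
qed

lemma free_module_hom_eqI:
  assumes M: "module R M"
    and f: "f \<in> mod_hom R (copower I (ring_module R (\<lambda>r. r))) M"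
    and g: "g \<in> mod_hom R (copower I (ring_module R (\<lambda>r. r))) M"
    and eq: "\<And>i. i \<in> I \<Longrightarrow> f (\<lambda>j\<in>I. if j = i then \<one>\<^bsub>R\<^esub> else \<zero>\<^bsub>R\<^esub>) =
                            g (\<lambda>j\<in>I. if j = i then \<one>\<^bsub>R\<^esub> else \<zero>\<^bsub>R\<^esub>)"
    and x: "x \<in> carrier (copower I (ring_module R (\<lambda>r. r)))"
  shows "f x = g x"
proof -
  interpret M: module R M by (rule M)
  let ?R = "ring_module R (\<lambda>r. r)"
  have RR: "module R ?R"
    by (rule ring_module_module) (auto intro: ring_hom_memI M.is_cring)
  note ring_module_simps [simp]
  from x show ?thesis
  proof (induction rule: copower_induct[OF RR, consumes 1, case_names 1 2])
    case 1
    then show ?case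
      using mod_hom_zero[OF copower_module[OF RR] M f] mod_hom_zero[OF copower_module[OF RR] M g]
      by simp
  next
    case (2 i t y)
    let ?u = "\<lambda>j\<in>I. if j = i then \<one>\<^bsub>R\<^esub> else \<zero>\<^bsub>R\<^esub>"
    let ?v = "\<lambda>j\<in>I. if j = i then t else \<zero>\<^bsub>?R\<^esub>"
    have u: "?u \<in> carrier (copower I ?R)"
      using copower_single_closed[OF RR \<open>i \<in> I\<close>, of "\<one>\<^bsub>R\<^esub>"]
    unfolding ring_module_simps by simp
    have v: "?v \<in> carrier (copower I ?R)"
      using copower_single_closed[OF RR \<open>i \<in> I\<close>, of t] 2 by simp
    have t: "t \<in> carrier R" using 2 by simp
    have "?v = t \<odot>\<^bsub>copower I ?R\<^esub> ?u"
      using t by (auto simp: copower_simps[OF RR] fun_eq_iff)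
    then have "f ?v = g ?v"
      using mod_hom_smult[OF f t u] mod_hom_smult[OF g t u] eq[OF \<open>i \<in> I\<close>] by simp
    then show ?case
      using mod_hom_add[OF f v] mod_hom_add[OF g v] 2 by simp
  qed
qed

lemma projective_lift:
  fixes P :: "('a, 'p) module"
  assumes P: "projective R P" and M: "module R M" and N: "module R N"
    and f: "f \<in> mod_epi R M N" and g: "g \<in> mod_hom R P N"
  obtains h where "h \<in> mod_hom R P M" and "\<And>x. x \<in> carrier P \<Longrightarrow> f (h x) = g x"
proof -
  interpret M: module R M by (rule M)
  let ?F = "\<lambda>I. copower I (ring_module R (\<lambda>r. r))"
  have RR: "module R (ring_module R (\<lambda>r. r))"
    by (rule ring_module_module) (auto intro: ring_hom_memI M.is_cring)
  obtain I :: "'p set" and \<iota> \<pi> where \<iota>: "\<iota> \<in> mod_hom R P (?F I)" and \<pi>: "\<pi> \<in> mod_hom R (?F I) P"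
    and \<pi>\<iota>: "\<And>x. x \<in> carrier P \<Longrightarrow> \<pi> (\<iota> x) = x"
    using P unfolding projective_def by blast
  let ?u = "\<lambda>i. \<lambda>j\<in>I. if j = i then \<one>\<^bsub>R\<^esub> else \<zero>\<^bsub>R\<^esub>"
  have u: "?u i \<in> carrier (?F I)" if "i \<in> I" for i
    using copower_single_closed[OF RR that, of "\<one>\<^bsub>R\<^esub>"]
    unfolding ring_module_simps by simp
  have g\<pi>: "(\<lambda>x. g (\<pi> x)) \<in> mod_hom R (?F I) N" by (rule mod_hom_comp[OF \<pi> g])
  have fh: "f \<in> mod_hom R M N" and fs: "f ` carrier M = carrier N"
    using f by (auto simp: mod_epi_def)
  have "\<exists>m\<in>carrier M. f m = g (\<pi> (?u i))" if "i \<in> I" for i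
    using mod_hom_closed[OF g\<pi> u[OF that]] fs by (metis (no_types, lifting) imageE)
  then obtain m where m: "\<And>i. i \<in> I \<Longrightarrow> m i \<in> carrier M"
    "\<And>i. i \<in> I \<Longrightarrow> f (m i) = g (\<pi> (?u i))" by metis
  have mI: "m \<in> I \<rightarrow> carrier M" using m(1) by auto
  obtain k where k: "k \<in> mod_hom R (?F I) M" "\<forall>i\<in>I. k (?u i) = m i"
    using free_module_hom[OF M mI] by (rule bexE)
  have "f (k x) = g (\<pi> x)" if "x \<in> carrier (?F I)" for x
    by (rule free_module_hom_eqI[OF N mod_hom_comp[OF k(1) fh] g\<pi> _ that]) (simp only: bspec[OF k(2)] m(2))
  then have "f (k (\<iota> x)) = g x" if "x \<in> carrier P" for x
    using that mod_hom_closed[OF \<iota> that] \<pi>\<iota>[OF that] by simp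
  with mod_hom_comp[OF \<iota> k(1)] show thesis by (rule that)
qed

lemma projectiveI_lift:
  fixes R :: "('a, 'k) ring_scheme" and P :: "('a, 'p) module"
  assumes P: "module R P"
    and lift: "\<And>(M :: ('a, 'p \<Rightarrow> 'a) module) (N :: ('a, 'p) module) f g.
      module R M \<Longrightarrow> module R N \<Longrightarrow> f \<in> mod_epi R M N \<Longrightarrow> g \<in> mod_hom R P N \<Longrightarrow>
      \<exists>h\<in>mod_hom R P M. \<forall>x\<in>carrier P. f (h x) = g x"
  shows "projective R P"
proof -
  interpret P: module R P by (rule P)
  let ?F = "copower (carrier P) (ring_module R (\<lambda>r. r))"
  have RR: "module R (ring_module R (\<lambda>r. r))"
    by (rule ring_module_module) (auto intro: ring_hom_memI P.is_cring)
  let ?u = "\<lambda>i. \<lambda>j\<in>carrier P. if j = i then \<one>\<^bsub>R\<^esub> else \<zero>\<^bsub>R\<^esub>"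
  have u: "?u i \<in> carrier ?F" if "i \<in> carrier P" for i
    using copower_single_closed[OF RR that, of "\<one>\<^bsub>R\<^esub>"]
    unfolding ring_module_simps by simp
  have id: "(\<lambda>x. x) \<in> carrier P \<rightarrow> carrier P" by simp
  obtain \<pi> where \<pi>: "\<pi> \<in> mod_hom R ?F P" "\<forall>i\<in>carrier P. \<pi> (?u i) = i"
    using free_module_hom[OF P id] by (rule bexE)
  have "carrier P \<subseteq> \<pi> ` carrier ?F"
  proof
    fix i assume i: "i \<in> carrier P"
    show "i \<in> \<pi> ` carrier ?F"
      by (rule image_eqI[where f = \<pi>, OF bspec[OF \<pi>(2) i, symmetric] u[OF i]])
  qed
  then have "\<pi> \<in> mod_epi R ?F P"
    using \<pi>(1) by (auto simp: mod_epi_def mod_hom_closed[OF \<pi>(1)])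
  moreover have "(\<lambda>x. x) \<in> mod_hom R P P" by (rule mod_homI) auto
  ultimately obtain \<iota> where "\<iota> \<in> mod_hom R P ?F" "\<forall>x\<in>carrier P. \<pi> (\<iota> x) = x"
    using lift[OF copower_module[OF RR] P] by blast
  with P \<pi>(1) show ?thesis unfolding projective_def by blast
qed

end

theory Submission
  imports Defs
begin

text \<open>
  Let \<open>X\<close> be an \<open>S\<close>-module, and regard it as an \<open>R\<close>-module by restriction of scalars along
  \<open>lam\<close>. Both classes that the silting condition compares can be read off from this restriction.

  The adjunction between \<open>_ \<otimes> S\<close> and restriction of scalars identifies the \<open>S\<close>-homomorphisms from
  \<open>P \<otimes> S\<close> and \<open>Q \<otimes> S\<close> to \<open>X\<close> with the \<open>R\<close>-homomorphisms from \<open>P\<close> and \<open>Q\<close> to \<open>X\<close>, naturally in \<open>\<sigma>\<close>. So \<open>X\<close>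
  is in the silting class of \<open>\<sigma> \<otimes> S\<close> if and only if its restriction is in that of \<open>\<sigma>\<close>
  (\<open>silting_class_base_change\<close>).

  A module is generated by the cokernel of \<open>\<sigma>\<close> if and only if every element is a finite sum of
  values of homomorphisms from \<open>Q\<close> that vanish on the image of \<open>\<sigma>\<close> (\<open>Gen_Coker_iff\<close>). For \<open>X\<close> over \<open>S\<close>,
  the adjunction shows that the values from \<open>Q \<otimes> S\<close> lie in the \<open>S\<close>-span of the values of the
  \<open>R\<close>-homomorphisms from \<open>Q\<close>. As \<open>S\<close> is commutative, \<open>s \<cdot> g\<close> is \<open>R\<close>-linear for every \<open>R\<close>-linear \<open>g\<close>, so that
  forming the \<open>S\<close>-span adds nothing. Hence \<open>X\<close> is generated by the cokernel of \<open>\<sigma> \<otimes> S\<close> if and only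
  if its restriction is generated by the cokernel of \<open>\<sigma>\<close> (\<open>Gen_Coker_base_change\<close>).

  The two classes therefore agree over \<open>S\<close> because they agree over \<open>R\<close>. The restriction of \<open>X\<close> has the
  same carrier as \<open>X\<close>, so the comparison takes place within modules on one and the same type.
  Projectivity of \<open>P \<otimes> S\<close> and \<open>Q \<otimes> S\<close> follows from the same adjunction (\<open>projective_base_change\<close>).
\<close>

section \<open>Generation as an internal condition\<close>

text \<open>
  The submonoid generated by \<open>A\<close>. It is described by its closure rules alone, so that it does not
  notice a change of scalars. For a set closed under negation, as are all those below, it is the
  subgroup generated by \<open>A\<close>.
\<close>

inductive_set add_closure :: "('m, 'k) ring_scheme \<Rightarrow> 'm set \<Rightarrow> 'm set" for M A where
  zero: "\<zero>\<^bsub>M\<^esub> \<in> add_closure M A"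
| add: "a \<in> A \<Longrightarrow> y \<in> add_closure M A \<Longrightarrow> a \<oplus>\<^bsub>M\<^esub> y \<in> add_closure M A"

lemma add_closure_mono: "A \<subseteq> B \<Longrightarrow> add_closure M A \<subseteq> add_closure M B"
proof
  show "x \<in> add_closure M B" if "A \<subseteq> B" "x \<in> add_closure M A" for x
    using that(2,1) by induction (auto intro: add_closure.intros)
qed

text \<open>
  The universal property of the direct sum. Additivity is that of a sum of group homomorphisms;
  linearity then only has to be checked on the summands, which generate.
\<close>

lemma copower_hom:
  assumes T: "module R T" and M: "module R M"
    and \<phi>: "\<And>i. i \<in> I \<Longrightarrow> \<phi> i \<in> mod_hom R T M"
  obtains h where "h \<in> mod_hom R (copower I T) M"
    and "\<And>i t. i \<in> I \<Longrightarrow> t \<in> carrier T \<Longrightarrow> h (\<lambda>j\<in>I. if j = i then t else \<zero>\<^bsub>T\<^esub>) = \<phi> i t"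
proof -
  interpret T: module R T by (rule T)
  interpret M: module R M by (rule M)
  interpret C: module R "copower I T" by (rule copower_module[OF T])
  let ?s = "\<lambda>i t. \<lambda>j\<in>I. if j = i then t else \<zero>\<^bsub>T\<^esub>"
  define h where "h x = gfinprod (add_monoid M) (\<lambda>i. \<phi> i (x i)) I" for x
  have "h \<in> hom (sum_group I (\<lambda>_. add_monoid T)) (add_monoid M)"
    unfolding h_def using \<phi> T.add.is_group
    by (intro M.add.hom_group_sum) (auto simp: mod_hom_def)
  then have hc: "h x \<in> carrier M" and ha: "h (x \<oplus>\<^bsub>copower I T\<^esub> y) = h x \<oplus>\<^bsub>M\<^esub> h y"
    if "x \<in> carrier (copower I T)" "y \<in> carrier (copower I T)" for x y
    using that by (auto simp: hom_def copower_def)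
  have hs: "h (?s i t) = \<phi> i t" if i: "i \<in> I" and t: "t \<in> carrier T" for i t
  proof -
    have "h (?s i t) = gfinprod (add_monoid M) (\<lambda>k. \<phi> k (?s i t k)) {i}"
      unfolding h_def using i t mod_hom_zero[OF T M \<phi>] mod_hom_closed[OF \<phi>]
      by (intro M.add.gfinprod_mono_neutral_cong_right) auto
    also have "\<dots> = \<phi> i t"
      using i t mod_hom_closed[OF \<phi>[OF i] t] by (simp add: M.add.finprod_singleton)
    finally show ?thesis .
  qed
  have h0: "h \<zero>\<^bsub>copower I T\<^esub> = \<zero>\<^bsub>M\<^esub>"
    using ha[of "\<zero>\<^bsub>copower I T\<^esub>" "\<zero>\<^bsub>copower I T\<^esub>"] hc[of "\<zero>\<^bsub>copower I T\<^esub>"]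
    by (metis C.M.zero_closed C.M.l_zero M.add.l_cancel_one)
  have hm: "h (r \<odot>\<^bsub>copower I T\<^esub> x) = r \<odot>\<^bsub>M\<^esub> h x"
    if r: "r \<in> carrier R" and x: "x \<in> carrier (copower I T)" for r x
    using x
  proof (induction rule: copower_induct[OF T, consumes 1, case_names zero add])
    case zero
    then show ?case using r by (simp add: h0)
  next
    case (add i t y)
    note s = copower_single_closed[OF T add.hyps(1)]
    have "r \<odot>\<^bsub>copower I T\<^esub> ?s i t = ?s i (r \<odot>\<^bsub>T\<^esub> t)"
      using r add.hyps by (auto simp: copower_simps[OF T] fun_eq_iff)
    then show ?case
      using r add s[of t] s[of "r \<odot>\<^bsub>T\<^esub> t"] mod_hom_smult[OF \<phi>[OF add.hyps(1)] r add.hyps(2)]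
      by (simp add: C.smult_r_distr ha hs hc M.smult_r_distr mod_hom_closed[OF \<phi>])
  qed
  show thesis
    by (rule that[of h]) (auto intro!: mod_homI simp: hc ha hm hs)
qed

text \<open>
  The image of an epimorphism from \<open>T\<^sup>(\<^sup>I\<^sup>)\<close> consists of finite sums of values of homomorphisms from \<open>T\<close>.
  Conversely, if such sums exhaust \<open>M\<close>, then the canonical map from the direct sum indexed by all
  homomorphisms from \<open>T\<close> to \<open>M\<close> is onto. In this form membership in \<^const>\<open>Gen\<close> no longer mentions an
  index set, and it can be compared over two different rings.
\<close>

lemma Gen_iff_add_closure:
  fixes T :: "('a, 't) module" and M :: "('a, 'x) module"
  assumes T: "module R T"
  shows "M \<in> Gen R T \<longleftrightarrow> module R M \<and>
    carrier M \<subseteq> add_closure M {f t | f t. f \<in> mod_hom R T M \<and> t \<in> carrier T}"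
    (is "_ \<longleftrightarrow> _ \<and> _ \<subseteq> add_closure M ?A")
proof (intro iffI conjI; (elim conjE)?)
  assume "M \<in> Gen R T"
  then obtain I :: "('t \<Rightarrow> 'x) set" and f where M: "module R M"
    and f: "f \<in> mod_hom R (copower I T) M" and onto: "f ` carrier (copower I T) = carrier M"
    by (auto simp: Gen_def mod_epi_def)
  show "module R M" by (rule M)
  have "f x \<in> add_closure M ?A" if "x \<in> carrier (copower I T)" for x
    using that
  proof (induction rule: copower_induct[OF T, consumes 1, case_names zero add])
    case zero
    then show ?case using mod_hom_zero[OF copower_module[OF T] M f] by (simp add: add_closure.zero)
  next
    case (add i t y)
    have "f (\<lambda>j\<in>I. if j = i then t else \<zero>\<^bsub>T\<^esub>) \<in> ?A"
      using mod_hom_comp[OF copower_single_hom[OF T add.hyps(1)] f] add.hyps(2)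
      by (intro CollectI exI conjI) auto
    then show ?case
      using mod_hom_add[OF f copower_single_closed[OF T add.hyps(1,2)] add.hyps(3)] add.IH
      by (simp add: add_closure.add)
  qed
  then have "f ` carrier (copower I T) \<subseteq> add_closure M ?A" by (rule image_subsetI)
  then show "carrier M \<subseteq> add_closure M ?A" by (simp only: onto)
next
  assume M: "module R M" and gen: "carrier M \<subseteq> add_closure M ?A"
  let ?I = "mod_hom R T M"
  interpret C: module R "copower ?I T" by (rule copower_module[OF T])
  obtain h where h: "h \<in> mod_hom R (copower ?I T) M"
    and hs: "\<And>f t. f \<in> ?I \<Longrightarrow> t \<in> carrier T \<Longrightarrow> h (\<lambda>j\<in>?I. if j = f then t else \<zero>\<^bsub>T\<^esub>) = f t"
    by (rule copower_hom[OF T M, of ?I "\<lambda>f. f"]) (assumption, rule that)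
  have "m \<in> h ` carrier (copower ?I T)" if "m \<in> add_closure M ?A" for m
    using that
  proof induction
    case zero
    show ?case using mod_hom_zero[OF copower_module[OF T] M h] C.M.zero_closed by (metis image_eqI)
  next
    case (add a y)
    then obtain f t x where ft: "f \<in> ?I" "t \<in> carrier T" "a = f t"
      and x: "x \<in> carrier (copower ?I T)" "y = h x" by blast
    note s = copower_single_closed[OF T ft(1,2)]
    show ?case
      using mod_hom_add[OF h s x(1)] hs[OF ft(1,2)] ft(3) x(2) C.M.a_closed[OF s x(1)]
      by (metis image_eqI)
  qed
  with gen have "h \<in> mod_epi R (copower ?I T) M"
    using h mod_hom_closed[OF h] by (auto simp: mod_epi_def)
  with M show "M \<in> Gen R T" unfolding Gen_def by blast
qed

section \<open>Quotients and cokernels\<close>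

lemma abelian_group_module_of_group:
  assumes "comm_group G"
  shows "abelian_group (module_of_group G act)"
proof -
  interpret comm_group G by fact
  have "comm_group (add_monoid (module_of_group G act))"
    by (rule comm_groupI) (auto simp: m_ac intro: l_inv_ex)
  then show ?thesis
    by (rule comm_group_abelian_groupI)
qed

text \<open>
  Actions and maps on quotients are defined by a union over the elements of a coset. All the
  sets in this union coincide when the map respects the subgroups, so the union is the image coset.
\<close>

lemma coset_map_eq:
  assumes f: "group_hom G H f" and K: "K \<lhd> G" and L: "L \<lhd> H"
    and fK: "\<And>k. k \<in> K \<Longrightarrow> f k \<in> L" and x: "x \<in> carrier G"
  shows "(\<Union>c\<in>K #>\<^bsub>G\<^esub> x. L #>\<^bsub>H\<^esub> f c) = L #>\<^bsub>H\<^esub> f x"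
proof -
  interpret f: group_hom G H f by fact
  interpret K: normal K G by fact
  interpret L: normal L H by fact
  have "L #>\<^bsub>H\<^esub> f c = L #>\<^bsub>H\<^esub> f x" if "c \<in> K #>\<^bsub>G\<^esub> x" for c
  proof -
    from that obtain k where k: "k \<in> K" "c = k \<otimes>\<^bsub>G\<^esub> x" by (auto simp: r_coset_def)
    then have "f c \<in> L #>\<^bsub>H\<^esub> f x" using x fK by (auto simp: r_coset_def)
    then show ?thesis
      using L.subgroup_axioms x f.H.repr_independence by (metis f.hom_closed)
  qed
  moreover have "x \<in> K #>\<^bsub>G\<^esub> x" using x K.subgroup_axioms f.G.rcos_self by blast
  ultimately show ?thesis by blast
qed

context
  fixes R :: "('a, 'k) ring_scheme" and Q :: "('a, 'q) module" and N :: "'q set"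
  assumes Q: "module R Q" and N: "submodule N R Q"
begin

interpretation Q: module R Q by (rule Q)
interpretation N: submodule N R Q by (rule N)

lemma submodule_normal: "N \<lhd> add_monoid Q"
  by (rule Q.add.subgroup_imp_normal[OF N.subgroup_axioms])

lemma carrier_quot_module: "carrier (quot_module Q N) = (\<lambda>x. N +>\<^bsub>Q\<^esub> x) ` carrier Q"
  by (simp add: quot_module_def A_FactGroup_def carrier_FactGroup a_r_coset_def)

lemma quot_module_add:
  "x \<in> carrier Q \<Longrightarrow> y \<in> carrier Q \<Longrightarrow>
    (N +>\<^bsub>Q\<^esub> x) \<oplus>\<^bsub>quot_module Q N\<^esub> (N +>\<^bsub>Q\<^esub> y) = N +>\<^bsub>Q\<^esub> (x \<oplus>\<^bsub>Q\<^esub> y)"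
  using normal.rcos_sum[OF submodule_normal]
  by (simp add: quot_module_def A_FactGroup_def a_r_coset_def)

lemma quot_module_smult:
  assumes "r \<in> carrier R" "x \<in> carrier Q"
  shows "r \<odot>\<^bsub>quot_module Q N\<^esub> (N +>\<^bsub>Q\<^esub> x) = N +>\<^bsub>Q\<^esub> (r \<odot>\<^bsub>Q\<^esub> x)"
proof -
  have "group_hom (add_monoid Q) (add_monoid Q) (\<lambda>x. r \<odot>\<^bsub>Q\<^esub> x)"
    using assms(1) by unfold_locales (auto simp: hom_def Q.smult_r_distr)
  from coset_map_eq[OF this submodule_normal submodule_normal] show ?thesis
    using assms by (simp add: quot_module_def a_r_coset_def)
qed

lemma quot_module_module: "module R (quot_module Q N)"
proof (rule moduleI)
  show "abelian_group (quot_module Q N)"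
    unfolding quot_module_def A_FactGroup_def
    by (rule abelian_group_module_of_group, rule Q.add.abelian_FactGroup, rule N.subgroup_axioms)
qed (auto simp: carrier_quot_module quot_module_add quot_module_smult Q.is_cring
      Q.smult_l_distr Q.smult_r_distr Q.smult_assoc1)

lemma quot_module_proj: "(\<lambda>x. N +>\<^bsub>Q\<^esub> x) \<in> mod_hom R Q (quot_module Q N)"
  by (rule mod_homI) (auto simp: carrier_quot_module quot_module_add quot_module_smult)

lemma quot_module_hom:
  assumes M: "module R M" and g: "g \<in> mod_hom R Q M" and gN: "\<And>n. n \<in> N \<Longrightarrow> g n = \<zero>\<^bsub>M\<^esub>"
  obtains f where "f \<in> mod_hom R (quot_module Q N) M"
    and "\<And>x. x \<in> carrier Q \<Longrightarrow> f (N +>\<^bsub>Q\<^esub> x) = g x"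
proof -
  interpret M: module R M by (rule M)
  interpret g: group_hom "add_monoid Q" "add_monoid M" g
    using g by unfold_locales (auto simp: mod_hom_def)
  have "N \<subseteq> kernel (add_monoid Q) (add_monoid M) g"
    using gN N.subset by (auto simp: kernel_def)
  then obtain f where f: "f \<in> hom (add_monoid Q Mod N) (add_monoid M)"
    and fg: "\<And>x. x \<in> carrier Q \<Longrightarrow> f (N +>\<^bsub>Q\<^esub> x) = g x"
    using g.FactGroup_universal_kernel[OF submodule_normal] by (auto simp: a_r_coset_def)
  have "f \<in> mod_hom R (quot_module Q N) M"
  proof (rule mod_homI)
    fix C D assume "C \<in> carrier (quot_module Q N)" "D \<in> carrier (quot_module Q N)"
    then show "f (C \<oplus>\<^bsub>quot_module Q N\<^esub> D) = f C \<oplus>\<^bsub>M\<^esub> f D"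
      using mod_hom_add[OF g] by (auto simp: carrier_quot_module quot_module_add fg)
  qed (use mod_hom_closed[OF g] mod_hom_smult[OF g] in
      \<open>auto simp: carrier_quot_module quot_module_smult fg\<close>)
  then show thesis using fg by (rule that)
qed

end

lemma image_submodule:
  assumes P: "module R P" and Q: "module R Q" and \<sigma>: "\<sigma> \<in> mod_hom R P Q"
  shows "submodule (\<sigma> ` carrier P) R Q"
proof -
  interpret P: module R P by (rule P)
  interpret Q: module R Q by (rule Q)
  interpret \<sigma>: group_hom "add_monoid P" "add_monoid Q" \<sigma>
    using \<sigma> by unfold_locales (auto simp: mod_hom_def)
  show ?thesis
    using \<sigma>.img_is_subgroup mod_hom_smult[OF \<sigma>, symmetric]
    by (auto simp: submodule_def submodule_axioms_def)
qed

text \<open>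
  Homomorphisms out of the cokernel of \<open>\<sigma>\<close> are homomorphisms out of \<open>Q\<close> that vanish on the image of
  \<open>\<sigma>\<close>, and both take the same values. This removes the cokernel from the description of \<^const>\<open>Gen\<close>.
\<close>

lemma Gen_Coker_iff:
  fixes X :: "('a, 'x) module"
  assumes P: "module R P" and Q: "module R Q" and \<sigma>: "\<sigma> \<in> mod_hom R P Q"
  shows "X \<in> Gen R (Coker P Q \<sigma>) \<longleftrightarrow> module R X \<and>
    carrier X \<subseteq> add_closure X {g y | g y. g \<in> mod_hom R Q X \<and>
      (\<forall>x\<in>carrier P. g (\<sigma> x) = \<zero>\<^bsub>X\<^esub>) \<and> y \<in> carrier Q}"
    (is "_ \<longleftrightarrow> _ \<and> _ \<subseteq> add_closure X ?B")
proof -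
  note N = image_submodule[OF P Q \<sigma>]
  let ?C = "Coker P Q \<sigma>"
  have C: "module R ?C" unfolding Coker_def by (rule quot_module_module[OF Q N])
  interpret Q: module R Q by (rule Q)
  have "{f t | f t. f \<in> mod_hom R ?C X \<and> t \<in> carrier ?C} = ?B" if X: "module R X"
  proof (intro equalityI subsetI)
    fix a assume "a \<in> {f t | f t. f \<in> mod_hom R ?C X \<and> t \<in> carrier ?C}"
    then obtain f y where f: "f \<in> mod_hom R ?C X" and y: "y \<in> carrier Q"
      "a = f ((\<sigma> ` carrier P) +>\<^bsub>Q\<^esub> y)"
      by (auto simp: Coker_def carrier_quot_module[OF Q N])
    let ?g = "\<lambda>y. f ((\<sigma> ` carrier P) +>\<^bsub>Q\<^esub> y)"
    have "?g (\<sigma> x) = \<zero>\<^bsub>X\<^esub>" if x: "x \<in> carrier P" for x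
    proof -
      have "(\<sigma> ` carrier P) +>\<^bsub>Q\<^esub> \<sigma> x = \<sigma> ` carrier P"
        using Q.add.coset_join2[of "\<sigma> x" "\<sigma> ` carrier P"] N x mod_hom_closed[OF \<sigma>]
        by (auto simp: a_r_coset_def submodule_def)
      also have "\<dots> = \<zero>\<^bsub>?C\<^esub>" by (simp add: Coker_def quot_module_def A_FactGroup_def)
      finally show ?thesis using mod_hom_zero[OF C X f] by simp
    qed
    moreover have "?g \<in> mod_hom R Q X"
      by (rule mod_hom_comp[OF quot_module_proj[OF Q N] f[unfolded Coker_def]])
    ultimately show "a \<in> ?B" using y by (intro CollectI exI[of _ ?g] exI[of _ y]) auto
  next
    fix a assume "a \<in> ?B"
    then obtain g y where g: "g \<in> mod_hom R Q X" "\<And>x. x \<in> carrier P \<Longrightarrow> g (\<sigma> x) = \<zero>\<^bsub>X\<^esub>"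
      and y: "y \<in> carrier Q" "a = g y" by blast
    obtain f where f: "f \<in> mod_hom R ?C X"
      "\<And>y. y \<in> carrier Q \<Longrightarrow> f ((\<sigma> ` carrier P) +>\<^bsub>Q\<^esub> y) = g y"
      using quot_module_hom[OF Q N X g(1)] g(2) unfolding Coker_def by (metis imageE)
    have "(\<sigma> ` carrier P) +>\<^bsub>Q\<^esub> y \<in> carrier ?C"
      using y by (auto simp: Coker_def carrier_quot_module[OF Q N])
    then show "a \<in> {f t | f t. f \<in> mod_hom R ?C X \<and> t \<in> carrier ?C}"
      using f y by (intro CollectI exI[of _ f] exI[of _ "(\<sigma> ` carrier P) +>\<^bsub>Q\<^esub> y"]) auto
  qed
  with Gen_iff_add_closure[OF C, of X] show ?thesis by auto
qed

section \<open>Tensor products\<close>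

abbreviation pair_group :: "('a, 'm) module \<Rightarrow> ('a, 'n) module \<Rightarrow> ('m \<times> 'n \<Rightarrow>\<^sub>0 int) monoid"
  where "pair_group M N \<equiv> free_Abelian_group (carrier M \<times> carrier N)"

definition pure_tensor ::
    "('a, 'k) ring_scheme \<Rightarrow> ('a, 'm) module \<Rightarrow> ('a, 'n) module \<Rightarrow> 'm \<Rightarrow> 'n \<Rightarrow> ('m \<times> 'n \<Rightarrow>\<^sub>0 int) set"
  where "pure_tensor R M N x y =
    tensor_kernel R M N #>\<^bsub>pair_group M N\<^esub> frag_of (x, y)"

context
  fixes R :: "('a, 'k) ring_scheme" and M :: "('a, 'm) module" and N :: "('a, 'n) module"
  assumes M: "module R M" and N: "module R N"
begin

interpretation M: module R M by (rule M)
interpretation N: module R N by (rule N)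

interpretation F: comm_group "pair_group M N" by (rule abelian_free_Abelian_group)

lemma tensor_relations_closed: "tensor_relations R M N \<subseteq> carrier (pair_group M N)"
proof -
  have diff: "a - b \<in> carrier (pair_group M N)"
    if "a \<in> carrier (pair_group M N)" "b \<in> carrier (pair_group M N)" for a b
    using that keys_diff[of a b] by auto
  show ?thesis
    unfolding tensor_relations_def
    by (intro Un_least subsetI; elim CollectE exE conjE; hypsubst)
       (intro diff; simp)+
qed

lemma tensor_kernel_subgroup: "subgroup (tensor_kernel R M N) (pair_group M N)"
  unfolding tensor_kernel_def by (rule F.generate_is_subgroup[OF tensor_relations_closed])

lemma tensor_kernel_normal: "tensor_kernel R M N \<lhd> pair_group M N"
  by (rule F.subgroup_imp_normal[OF tensor_kernel_subgroup])

interpretation K: normal "tensor_kernel R M N" "pair_group M N" by (rule tensor_kernel_normal)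

lemma tensor_group_comm_group: "comm_group (tensor_group R M N)"
  unfolding tensor_group_def by (rule F.abelian_FactGroup[OF tensor_kernel_subgroup])

interpretation TG: comm_group "tensor_group R M N" by (rule tensor_group_comm_group)

lemma carrier_tensor_group:
  "carrier (tensor_group R M N) =
    (\<lambda>c. tensor_kernel R M N #>\<^bsub>pair_group M N\<^esub> c) ` carrier (pair_group M N)"
  unfolding tensor_group_def by (rule carrier_FactGroup)

lemma tensor_group_mult:
  "a \<in> carrier (pair_group M N) \<Longrightarrow> b \<in> carrier (pair_group M N) \<Longrightarrow>
    (tensor_kernel R M N #>\<^bsub>pair_group M N\<^esub> a) \<otimes>\<^bsub>tensor_group R M N\<^esub>
      (tensor_kernel R M N #>\<^bsub>pair_group M N\<^esub> b) =
    tensor_kernel R M N #>\<^bsub>pair_group M N\<^esub> (a + b)"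
  using K.rcos_sum by (simp add: tensor_group_def)

lemma tensor_group_one: "\<one>\<^bsub>tensor_group R M N\<^esub> = tensor_kernel R M N #>\<^bsub>pair_group M N\<^esub> 0"
  using F.coset_join2[of 0 "tensor_kernel R M N"] tensor_kernel_subgroup K.one_closed
  by (simp add: tensor_group_def)

lemma tensor_coset_eqI:
  assumes "a \<in> carrier (pair_group M N)" "b \<in> carrier (pair_group M N)" "a - b \<in> tensor_kernel R M N"
  shows "tensor_kernel R M N #>\<^bsub>pair_group M N\<^esub> a = tensor_kernel R M N #>\<^bsub>pair_group M N\<^esub> b"
proof -
  have "a = (a - b) \<otimes>\<^bsub>pair_group M N\<^esub> b" by simp
  then have "a \<in> tensor_kernel R M N #>\<^bsub>pair_group M N\<^esub> b" using assms(3) unfolding r_coset_def by blast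
  then show ?thesis using assms(2) F.repr_independence tensor_kernel_subgroup by metis
qed

lemma pure_tensor_closed:
  "x \<in> carrier M \<Longrightarrow> y \<in> carrier N \<Longrightarrow> pure_tensor R M N x y \<in> carrier (tensor_group R M N)"
  by (auto simp: pure_tensor_def carrier_tensor_group)

lemma pure_tensor_add_left:
  assumes "x \<in> carrier M" "x' \<in> carrier M" "y \<in> carrier N"
  shows "pure_tensor R M N (x \<oplus>\<^bsub>M\<^esub> x') y =
    pure_tensor R M N x y \<otimes>\<^bsub>tensor_group R M N\<^esub> pure_tensor R M N x' y"
proof -
  have "frag_of (x \<oplus>\<^bsub>M\<^esub> x', y) - (frag_of (x, y) + frag_of (x', y)) \<in> tensor_kernel R M N"
    unfolding tensor_kernel_def diff_diff_eq[symmetric] using assms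
    by (intro generate.incl) (auto simp: tensor_relations_def)
  then show ?thesis
    unfolding pure_tensor_def using assms keys_add[of "frag_of (x, y)" "frag_of (x', y)"]
    by (subst tensor_group_mult, simp, simp) (rule tensor_coset_eqI, auto)
qed

lemma pure_tensor_add_right:
  assumes "x \<in> carrier M" "y \<in> carrier N" "y' \<in> carrier N"
  shows "pure_tensor R M N x (y \<oplus>\<^bsub>N\<^esub> y') =
    pure_tensor R M N x y \<otimes>\<^bsub>tensor_group R M N\<^esub> pure_tensor R M N x y'"
proof -
  have "frag_of (x, y \<oplus>\<^bsub>N\<^esub> y') - (frag_of (x, y) + frag_of (x, y')) \<in> tensor_kernel R M N"
    unfolding tensor_kernel_def diff_diff_eq[symmetric] using assms
    by (intro generate.incl) (auto simp: tensor_relations_def)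
  then show ?thesis
    unfolding pure_tensor_def using assms keys_add[of "frag_of (x, y)" "frag_of (x, y')"]
    by (subst tensor_group_mult, simp, simp) (rule tensor_coset_eqI, auto)
qed

lemma pure_tensor_smult:
  assumes "r \<in> carrier R" "x \<in> carrier M" "y \<in> carrier N"
  shows "pure_tensor R M N (r \<odot>\<^bsub>M\<^esub> x) y = pure_tensor R M N x (r \<odot>\<^bsub>N\<^esub> y)"
proof -
  have "frag_of (r \<odot>\<^bsub>M\<^esub> x, y) - frag_of (x, r \<odot>\<^bsub>N\<^esub> y) \<in> tensor_kernel R M N"
    unfolding tensor_kernel_def using assms
    by (intro generate.incl) (auto simp: tensor_relations_def)
  then show ?thesis
    unfolding pure_tensor_def using assms by (intro tensor_coset_eqI) auto
qed

text \<open>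
  Negatives of pure tensors are pure, which is why sums of pure tensors exhaust the tensor product
  in the induction rule that follows.
\<close>

lemma pure_tensor_minus:
  assumes "x \<in> carrier M" "y \<in> carrier N"
  shows "pure_tensor R M N (\<ominus>\<^bsub>M\<^esub> x) y = inv\<^bsub>tensor_group R M N\<^esub> pure_tensor R M N x y"
proof -
  let ?t = "\<lambda>x. pure_tensor R M N x y"
  have "?t \<zero>\<^bsub>M\<^esub> = ?t \<zero>\<^bsub>M\<^esub> \<otimes>\<^bsub>tensor_group R M N\<^esub> ?t \<zero>\<^bsub>M\<^esub>"
    using pure_tensor_add_left[of "\<zero>\<^bsub>M\<^esub>" "\<zero>\<^bsub>M\<^esub>" y] assms by simp
  then have "?t \<zero>\<^bsub>M\<^esub> = \<one>\<^bsub>tensor_group R M N\<^esub>"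
    using pure_tensor_closed[of "\<zero>\<^bsub>M\<^esub>" y] assms by (metis M.M.zero_closed TG.l_cancel_one')
  then have "?t (\<ominus>\<^bsub>M\<^esub> x) \<otimes>\<^bsub>tensor_group R M N\<^esub> ?t x = \<one>\<^bsub>tensor_group R M N\<^esub>"
    using pure_tensor_add_left[of "\<ominus>\<^bsub>M\<^esub> x" x y] assms by (simp add: M.M.l_neg)
  then show ?thesis
    using assms pure_tensor_closed by (intro TG.inv_equality[symmetric]) auto
qed

lemma tensor_induct [consumes 1, case_names one mult]:
  assumes z: "z \<in> carrier (tensor_group R M N)"
    and one: "A \<one>\<^bsub>tensor_group R M N\<^esub>"
    and mult: "\<And>x y z. x \<in> carrier M \<Longrightarrow> y \<in> carrier N \<Longrightarrow> z \<in> carrier (tensor_group R M N) \<Longrightarrow>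
      A z \<Longrightarrow> A (pure_tensor R M N x y \<otimes>\<^bsub>tensor_group R M N\<^esub> z)"
  shows "A z"
proof -
  let ?T = "tensor_group R M N"
  let ?c = "\<lambda>c. tensor_kernel R M N #>\<^bsub>pair_group M N\<^esub> c"
  have cc: "?c c \<in> carrier ?T" "?c (-c) \<in> carrier ?T" "inv\<^bsub>?T\<^esub> ?c c = ?c (- c)"
    if "Poly_Mapping.keys c \<subseteq> carrier M \<times> carrier N" for c
  proof -
    show c: "?c c \<in> carrier ?T" "?c (-c) \<in> carrier ?T" using that by (auto simp: carrier_tensor_group)
    show "inv\<^bsub>?T\<^esub> ?c c = ?c (- c)"
      using c that tensor_group_mult[of "-c" c]
      by (intro TG.inv_equality) (simp_all add: tensor_group_one)
  qed
  (* The class of c is added to an arbitrary z, and both signs are treated at once, so that the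
     induction over differences in the free group goes through. *)
  have "\<forall>z\<in>carrier ?T. A z \<longrightarrow> A (?c c \<otimes>\<^bsub>?T\<^esub> z) \<and> A (?c (- c) \<otimes>\<^bsub>?T\<^esub> z)"
    if "Poly_Mapping.keys c \<subseteq> carrier M \<times> carrier N" for c
    using that
  proof (induction c rule: free_Abelian_group_induct[consumes 1])
    case 1
    show ?case by (simp flip: tensor_group_one)
  next
    case (2 a b)
    have "?c (a - b) = ?c a \<otimes>\<^bsub>?T\<^esub> ?c (- b)" "?c (- (a - b)) = ?c b \<otimes>\<^bsub>?T\<^esub> ?c (- a)"
      using 2 tensor_group_mult[of a "- b"] tensor_group_mult[of b "- a"] by simp_all
    then show ?case using 2 cc by (simp add: TG.m_assoc)
  next
    case (3 p)
    then obtain x y where p: "p = (x, y)" "x \<in> carrier M" "y \<in> carrier N" by auto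
    then have "?c (- frag_of p) = pure_tensor R M N (\<ominus>\<^bsub>M\<^esub> x) y"
      using cc(3)[of "frag_of p"] pure_tensor_minus[of x y] by (simp add: pure_tensor_def)
    then show ?case
      using mult p M.M.a_inv_closed by (auto simp: pure_tensor_def)
  qed
  moreover obtain c where "c \<in> carrier (pair_group M N)" "z = ?c c" using z by (auto simp: carrier_tensor_group)
  ultimately show ?thesis using one TG.one_closed cc by (metis TG.r_one carrier_free_Abelian_group_iff)
qed

text \<open>
  The universal property: the homomorphism out of the free group that extends \<open>\<beta>\<close> kills the defining
  relations, hence the subgroup that they generate.
\<close>

lemma tensor_hom:
  assumes A: "comm_group A"
    and \<beta>: "\<And>x y. x \<in> carrier M \<Longrightarrow> y \<in> carrier N \<Longrightarrow> \<beta> x y \<in> carrier A"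
    and add_left: "\<And>x x' y. x \<in> carrier M \<Longrightarrow> x' \<in> carrier M \<Longrightarrow> y \<in> carrier N \<Longrightarrow>
      \<beta> (x \<oplus>\<^bsub>M\<^esub> x') y = \<beta> x y \<otimes>\<^bsub>A\<^esub> \<beta> x' y"
    and add_right: "\<And>x y y'. x \<in> carrier M \<Longrightarrow> y \<in> carrier N \<Longrightarrow> y' \<in> carrier N \<Longrightarrow>
      \<beta> x (y \<oplus>\<^bsub>N\<^esub> y') = \<beta> x y \<otimes>\<^bsub>A\<^esub> \<beta> x y'"
    and balanced: "\<And>r x y. r \<in> carrier R \<Longrightarrow> x \<in> carrier M \<Longrightarrow> y \<in> carrier N \<Longrightarrow>
      \<beta> (r \<odot>\<^bsub>M\<^esub> x) y = \<beta> x (r \<odot>\<^bsub>N\<^esub> y)"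
  obtains h where "h \<in> hom (tensor_group R M N) A"
    and "\<And>x y. x \<in> carrier M \<Longrightarrow> y \<in> carrier N \<Longrightarrow> h (pure_tensor R M N x y) = \<beta> x y"
proof -
  interpret A: comm_group A by (rule A)
  have "(\<lambda>(x, y). \<beta> x y) ` (carrier M \<times> carrier N) \<subseteq> carrier A" using \<beta> by auto
  from A.free_Abelian_group_universal[OF this]
  obtain h where h: "h \<in> hom (pair_group M N) A"
    and hf: "\<And>p. p \<in> carrier M \<times> carrier N \<Longrightarrow> h (frag_of p) = (\<lambda>(x, y). \<beta> x y) p" by metis
  interpret h: group_hom "pair_group M N" A h using h by unfold_locales
  have d2: "h (frag_of p - frag_of q) = h (frag_of p) \<otimes>\<^bsub>A\<^esub> inv\<^bsub>A\<^esub> h (frag_of q)"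
    if "p \<in> carrier M \<times> carrier N" "q \<in> carrier M \<times> carrier N" for p q
    using that h.hom_mult[of "frag_of p" "- frag_of q"] h.hom_inv[of "frag_of q"] by simp
  have d3: "h (frag_of p - frag_of q - frag_of s) =
      h (frag_of p) \<otimes>\<^bsub>A\<^esub> inv\<^bsub>A\<^esub> (h (frag_of q) \<otimes>\<^bsub>A\<^esub> h (frag_of s))"
    if "p \<in> carrier M \<times> carrier N" "q \<in> carrier M \<times> carrier N" "s \<in> carrier M \<times> carrier N" for p q s
  proof -
    have k: "Poly_Mapping.keys (frag_of q + frag_of s) \<subseteq> carrier M \<times> carrier N"
      using that keys_add[of "frag_of q" "frag_of s"] by auto
    then show ?thesis
      using that h.hom_mult[of "frag_of p" "- (frag_of q + frag_of s)"]
        h.hom_inv[of "frag_of q + frag_of s"] h.hom_mult[of "frag_of q" "frag_of s"]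
      by (simp add: diff_diff_eq keys_minus del: minus_add_distrib)
  qed
  have "tensor_relations R M N \<subseteq> kernel (pair_group M N) A h"
  proof
    fix c assume c: "c \<in> tensor_relations R M N"
    then have "h c = \<one>\<^bsub>A\<^esub>"
      unfolding tensor_relations_def
      by (auto simp: d2 d3 hf add_left add_right balanced \<beta>)
    with subsetD[OF tensor_relations_closed c] show "c \<in> kernel (pair_group M N) A h" by (simp add: kernel_def)
  qed
  then have "tensor_kernel R M N \<subseteq> kernel (pair_group M N) A h"
    unfolding tensor_kernel_def by (rule F.generate_subgroup_incl[OF _ h.subgroup_kernel])
  from h.FactGroup_universal_kernel[OF tensor_kernel_normal this]
  obtain g where "g \<in> hom (pair_group M N Mod tensor_kernel R M N) A"
    "\<And>c. c \<in> carrier (pair_group M N) \<Longrightarrow> g (tensor_kernel R M N #>\<^bsub>pair_group M N\<^esub> c) = h c" by blast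
  then show thesis
    using hf by (intro that[of g]) (auto simp: tensor_group_def pure_tensor_def)
qed

end

context
  fixes R :: "('a, 'k) ring_scheme" and M :: "('a, 'm) module" and N :: "('a, 'n) module"
    and M' :: "('a, 'm') module" and N' :: "('a, 'n') module" and f g
  assumes M: "module R M" and N: "module R N" and M': "module R M'" and N': "module R N'"
    and f: "f \<in> mod_hom R M M'" and g: "g \<in> mod_hom R N N'"
begin

interpretation F: comm_group "pair_group M N" by (rule abelian_free_Abelian_group)
interpretation F': comm_group "pair_group M' N'" by (rule abelian_free_Abelian_group)

lemma pair_map_hom:
  "frag_extend (\<lambda>(x, y). frag_of (f x, g y)) \<in> hom (pair_group M N) (pair_group M' N')"
proof -
  have "Poly_Mapping.keys (frag_extend (\<lambda>(x, y). frag_of (f x, g y)) c) \<subseteq> carrier M' \<times> carrier N'"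
    if "Poly_Mapping.keys c \<subseteq> carrier M \<times> carrier N" for c
    using keys_frag_extend[of "\<lambda>(x, y). frag_of (f x, g y)" c] that
      mod_hom_closed[OF f] mod_hom_closed[OF g] by fastforce
  then show ?thesis by (intro homI) (simp_all add: frag_extend_add)
qed

text \<open>
  The map induced on the free groups sends defining relations to defining relations, so it respects
  the two kernels, and the union in the definition of \<^const>\<open>tensor_map\<close> is over equal cosets.
\<close>

lemma tensor_map_coset:
  assumes c: "c \<in> carrier (pair_group M N)"
  shows "tensor_map R M' N' f g (tensor_kernel R M N #>\<^bsub>pair_group M N\<^esub> c) =
    tensor_kernel R M' N' #>\<^bsub>pair_group M' N'\<^esub> frag_extend (\<lambda>(x, y). frag_of (f x, g y)) c"
proof -
  let ?e = "frag_extend (\<lambda>(x, y). frag_of (f x, g y))"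
  interpret e: group_hom "pair_group M N" "pair_group M' N'" ?e
    by unfold_locales (rule pair_map_hom)
  have "?e ` tensor_relations R M N \<subseteq> tensor_relations R M' N'"
  proof
    fix d assume "d \<in> ?e ` tensor_relations R M N"
    then obtain c where c: "c \<in> tensor_relations R M N" "d = ?e c" by blast
    note rules = mod_hom_add[OF f] mod_hom_add[OF g] mod_hom_smult[OF f] mod_hom_smult[OF g]
    note closed = mod_hom_closed[OF f] mod_hom_closed[OF g]
    from c(1) show "d \<in> tensor_relations R M' N'"
      unfolding tensor_relations_def Un_iff c(2)
      by (elim disjE CollectE exE conjE; hypsubst)
         (simp add: frag_extend_diff rules, use closed in blast)+
  qed
  then have "?e ` tensor_kernel R M N \<subseteq> tensor_kernel R M' N'"
    unfolding tensor_kernel_def e.generate_img[OF tensor_relations_closed[OF M N], symmetric]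
    using F'.mono_generate e.generate_img[OF tensor_relations_closed[OF M N]] by metis
  then show ?thesis
    unfolding tensor_map_def
    by (intro coset_map_eq[OF e.group_hom_axioms tensor_kernel_normal[OF M N]
          tensor_kernel_normal[OF M' N'] _ c]) auto
qed

lemma tensor_map_pure_tensor:
  assumes "x \<in> carrier M" "y \<in> carrier N"
  shows "tensor_map R M' N' f g (pure_tensor R M N x y) = pure_tensor R M' N' (f x) (g y)"
  using assms by (simp add: pure_tensor_def tensor_map_coset)

lemma tensor_map_hom: "tensor_map R M' N' f g \<in> hom (tensor_group R M N) (tensor_group R M' N')"
proof -
  have add: "Poly_Mapping.keys (c + d) \<subseteq> carrier M \<times> carrier N"
    if "Poly_Mapping.keys c \<subseteq> carrier M \<times> carrier N" "Poly_Mapping.keys d \<subseteq> carrier M \<times> carrier N" for c d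
    using that keys_add[of c d] by auto
  show ?thesis
    by (rule homI)
       (auto simp: carrier_tensor_group[OF M N] carrier_tensor_group[OF M' N'] tensor_map_coset
          tensor_group_mult[OF M N] tensor_group_mult[OF M' N'] frag_extend_add add
          hom_in_carrier[OF pair_map_hom, simplified])
qed

end

section \<open>Restriction and extension of scalars\<close>

definition restrict_scalars :: "('a \<Rightarrow> 'b) \<Rightarrow> ('b, 'x) module \<Rightarrow> ('a, 'x) module"
  where "restrict_scalars lam X = module_of_group (add_monoid X) (\<lambda>r x. lam r \<odot>\<^bsub>X\<^esub> x)"

lemma restrict_scalars_simps [simp]:
  "carrier (restrict_scalars lam X) = carrier X"
  "\<zero>\<^bsub>restrict_scalars lam X\<^esub> = \<zero>\<^bsub>X\<^esub>"
  "add (restrict_scalars lam X) = add X"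
  "r \<odot>\<^bsub>restrict_scalars lam X\<^esub> x = lam r \<odot>\<^bsub>X\<^esub> x"
  by (simp_all add: restrict_scalars_def)

lemma add_closure_restrict_scalars: "add_closure (restrict_scalars lam X) A = add_closure X A"
proof (intro equalityI subsetI)
  show "x \<in> add_closure X A" if "x \<in> add_closure (restrict_scalars lam X) A" for x
    using that by induction (simp_all add: add_closure.intros)
  show "x \<in> add_closure (restrict_scalars lam X) A" if "x \<in> add_closure X A" for x
    using that
  proof induction
    case zero
    show ?case using add_closure.zero[of "restrict_scalars lam X"] by simp
  next
    case (add a y)
    then show ?case using add_closure.add[of a A y "restrict_scalars lam X"] by simp
  qed
qed

text \<open>
  The unit \<open>x \<mapsto> x \<otimes> 1\<close> of the adjunction between extension and restriction of scalars.
\<close>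

definition base_change_unit ::
    "('a, 'k) ring_scheme \<Rightarrow> ('b, 'l) ring_scheme \<Rightarrow> ('a \<Rightarrow> 'b) \<Rightarrow> ('a, 'm) module \<Rightarrow>
     'm \<Rightarrow> ('m \<times> 'b \<Rightarrow>\<^sub>0 int) set"
  where "base_change_unit R S lam M x = pure_tensor R M (ring_module S lam) x \<one>\<^bsub>S\<^esub>"

context
  fixes R :: "('a, 'k) ring_scheme" and S :: "('b, 'l) ring_scheme" and lam :: "'a \<Rightarrow> 'b"
  assumes R: "cring R" and S: "cring S" and lam: "lam \<in> ring_hom R S"
begin

interpretation R: cring R by (rule R)
interpretation S: cring S by (rule S)
interpretation lam: ring_hom_cring R S lam by unfold_locales (rule lam)

lemma restrict_scalars_module:
  assumes X: "module S X"
  shows "module R (restrict_scalars lam X)"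
proof -
  interpret X: module S X by (rule X)
  have "abelian_group (restrict_scalars lam X)"
    unfolding restrict_scalars_def by (rule abelian_group_module_of_group[OF X.add.comm_group_axioms])
  then show ?thesis
    by (intro moduleI) (auto simp: R X.smult_l_distr X.smult_r_distr X.smult_assoc1)
qed

lemma mod_hom_restrict_scalars:
  assumes "f \<in> mod_hom S X Y"
  shows "f \<in> mod_hom R (restrict_scalars lam X) (restrict_scalars lam Y)"
  using assms by (intro mod_homI) (auto simp: mod_hom_closed mod_hom_add mod_hom_smult)

text \<open>
  The set of \<open>R\<close>-homomorphisms into an \<open>S\<close>-module is stable under scalars from \<open>S\<close>. Commutativity of \<open>S\<close>
  enters here: multiplication by \<open>s\<close> commutes with the action of the image of \<open>R\<close>.
\<close>

lemma mod_hom_restrict_scalars_smult: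
  assumes X: "module S X" and f: "f \<in> mod_hom R M (restrict_scalars lam X)" and s: "s \<in> carrier S"
  shows "(\<lambda>x. s \<odot>\<^bsub>X\<^esub> f x) \<in> mod_hom R M (restrict_scalars lam X)"
proof -
  interpret X: module S X by (rule X)
  show ?thesis
    using mod_hom_closed[OF f] mod_hom_add[OF f] mod_hom_smult[OF f] s
    by (intro mod_homI) (simp_all add: X.smult_r_distr S.m_comm flip: X.smult_assoc1)
qed

lemma extension_ring_module: "module R (ring_module S lam)"
  by (rule ring_module_module[OF R S lam])

lemma ring_module_mult_hom:
  "s \<in> carrier S \<Longrightarrow> (\<lambda>t. s \<otimes>\<^bsub>S\<^esub> t) \<in> mod_hom R (ring_module S lam) (ring_module S lam)"
  by (rule mod_homI) (auto simp: ring_module_simps S.r_distr S.m_lcomm)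

context
  fixes M :: "('a, 'm) module"
  assumes M: "module R M"
begin

interpretation M: module R M by (rule M)

lemma base_change_simps:
  "carrier (base_change R S lam M) = carrier (tensor_group R M (ring_module S lam))"
  "\<zero>\<^bsub>base_change R S lam M\<^esub> = \<one>\<^bsub>tensor_group R M (ring_module S lam)\<^esub>"
  "add (base_change R S lam M) = mult (tensor_group R M (ring_module S lam))"
  by (simp_all add: base_change_def)

lemmas base_change_pure_rules =
  pure_tensor_closed[OF M extension_ring_module, folded base_change_simps, unfolded ring_module_simps]
  pure_tensor_add_left[OF M extension_ring_module, folded base_change_simps, unfolded ring_module_simps]
  pure_tensor_add_right[OF M extension_ring_module, folded base_change_simps, unfolded ring_module_simps]
  pure_tensor_smult[OF M extension_ring_module, folded base_change_simps, unfolded ring_module_simps]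

lemmas base_change_induct [consumes 1, case_names zero add] =
  tensor_induct[OF M extension_ring_module, folded base_change_simps, unfolded ring_module_simps]

lemma base_change_smult_hom:
  assumes "s \<in> carrier S"
  shows "smult (base_change R S lam M) s \<in>
    hom (tensor_group R M (ring_module S lam)) (tensor_group R M (ring_module S lam))"
proof -
  have id: "(\<lambda>x. x) \<in> mod_hom R M M" by (rule mod_homI) auto
  show ?thesis
    using tensor_map_hom[OF M extension_ring_module M extension_ring_module id ring_module_mult_hom[OF assms]]
    by (simp add: base_change_def)
qed

lemma base_change_smult_pure:
  assumes "s \<in> carrier S" "x \<in> carrier M" "t \<in> carrier S"
  shows "s \<odot>\<^bsub>base_change R S lam M\<^esub> pure_tensor R M (ring_module S lam) x t =
    pure_tensor R M (ring_module S lam) x (s \<otimes>\<^bsub>S\<^esub> t)"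
proof -
  have id: "(\<lambda>x. x) \<in> mod_hom R M M" by (rule mod_homI) auto
  show ?thesis
    using tensor_map_pure_tensor[OF M extension_ring_module M extension_ring_module id ring_module_mult_hom]
      assms by (simp add: base_change_def ring_module_simps)
qed

text \<open>
  The action of a scalar is additive, being an induced map of tensor products. The remaining axioms
  are additive in the element acted on, hence need only be checked on pure tensors, where they
  become identities of \<open>S\<close>.
\<close>

lemma base_change_module: "module S (base_change R S lam M)"
proof -
  let ?B = "base_change R S lam M"
  have ab: "abelian_group ?B"
    unfolding base_change_def
    by (rule abelian_group_module_of_group[OF tensor_group_comm_group[OF M extension_ring_module]])
  interpret B: abelian_group ?B by (rule ab)
  note pt = base_change_pure_rules(1)
  have cl: "s \<odot>\<^bsub>?B\<^esub> z \<in> carrier ?B" if "s \<in> carrier S" "z \<in> carrier ?B" for s z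
    using hom_in_carrier[OF base_change_smult_hom] that by (simp add: base_change_simps)
  have B_add: "s \<odot>\<^bsub>?B\<^esub> (z \<oplus>\<^bsub>?B\<^esub> w) = s \<odot>\<^bsub>?B\<^esub> z \<oplus>\<^bsub>?B\<^esub> s \<odot>\<^bsub>?B\<^esub> w"
    if "s \<in> carrier S" "z \<in> carrier ?B" "w \<in> carrier ?B" for s z w
    using hom_mult[OF base_change_smult_hom] that by (simp add: base_change_simps)
  have zero: "s \<odot>\<^bsub>?B\<^esub> \<zero>\<^bsub>?B\<^esub> = \<zero>\<^bsub>?B\<^esub>" if "s \<in> carrier S" for s
    using B_add[OF that B.zero_closed B.zero_closed] cl[OF that B.zero_closed]
    by (metis B.zero_closed B.l_zero B.add.l_cancel_one')
  show ?thesis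
  proof (rule moduleI)
    fix a b z assume ab: "a \<in> carrier S" "b \<in> carrier S" and z: "z \<in> carrier ?B"
    from z show "(a \<oplus>\<^bsub>S\<^esub> b) \<odot>\<^bsub>?B\<^esub> z = a \<odot>\<^bsub>?B\<^esub> z \<oplus>\<^bsub>?B\<^esub> b \<odot>\<^bsub>?B\<^esub> z"
    proof (induction rule: base_change_induct)
      case (add x y z)
      then show ?case
        using ab by (simp add: B_add pt cl base_change_smult_pure S.l_distr
            base_change_pure_rules(3) B.a_ac)
    qed (simp add: zero ab)
    from z show "(a \<otimes>\<^bsub>S\<^esub> b) \<odot>\<^bsub>?B\<^esub> z = a \<odot>\<^bsub>?B\<^esub> (b \<odot>\<^bsub>?B\<^esub> z)"
    proof (induction rule: base_change_induct)
      case (add x y z)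
      then show ?case
        using ab by (simp add: B_add pt cl base_change_smult_pure S.m_assoc)
    qed (simp add: zero ab)
  next
    fix z assume z: "z \<in> carrier ?B"
    then show "\<one>\<^bsub>S\<^esub> \<odot>\<^bsub>?B\<^esub> z = z"
    proof (induction rule: base_change_induct)
      case (add x y z)
      then show ?case
        by (simp add: B_add pt cl base_change_smult_pure)
    qed (simp add: zero)
  qed (simp_all add: S ab cl B_add)
qed

interpretation B: module S "base_change R S lam M" by (rule base_change_module)

lemma base_change_unit_hom:
  "base_change_unit R S lam M \<in> mod_hom R M (restrict_scalars lam (base_change R S lam M))"
  by (rule mod_homI)
     (simp_all add: base_change_unit_def base_change_pure_rules ring_module_simps base_change_smult_pure)

lemma base_change_pure_eq_smult_unit:
  "x \<in> carrier M \<Longrightarrow> s \<in> carrier S \<Longrightarrow>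
    pure_tensor R M (ring_module S lam) x s = s \<odot>\<^bsub>base_change R S lam M\<^esub> base_change_unit R S lam M x"
  by (simp add: base_change_unit_def base_change_smult_pure)

text \<open>
  Existence in the adjunction: \<open>g\<close> extends to \<open>M \<otimes> S\<close> by \<open>x \<otimes> s \<mapsto> s \<cdot> g x\<close>.
\<close>

lemma base_change_hom:
  assumes X: "module S X" and g: "g \<in> mod_hom R M (restrict_scalars lam X)"
  obtains h where "h \<in> mod_hom S (base_change R S lam M) X"
    and "\<And>x. x \<in> carrier M \<Longrightarrow> h (base_change_unit R S lam M x) = g x"
proof -
  interpret X: module S X by (rule X)
  let ?B = "base_change R S lam M"
  note g_rules = mod_hom_closed[OF g] mod_hom_add[OF g] mod_hom_smult[OF g]
  obtain h where h: "h \<in> hom (tensor_group R M (ring_module S lam)) (add_monoid X)"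
    and hp: "\<And>x s. x \<in> carrier M \<Longrightarrow> s \<in> carrier (ring_module S lam) \<Longrightarrow>
      h (pure_tensor R M (ring_module S lam) x s) = s \<odot>\<^bsub>X\<^esub> g x"
    by (rule tensor_hom[OF M extension_ring_module X.add.comm_group_axioms, of "\<lambda>x s. s \<odot>\<^bsub>X\<^esub> g x"])
       (use g_rules in \<open>auto simp: ring_module_simps X.smult_l_distr X.smult_r_distr S.m_comm
          simp flip: X.smult_assoc1\<close>)
  have hc: "h z \<in> carrier X" if "z \<in> carrier ?B" for z
    using hom_in_carrier[OF h] that by (simp add: base_change_simps)
  have ha: "h (z \<oplus>\<^bsub>?B\<^esub> w) = h z \<oplus>\<^bsub>X\<^esub> h w" if "z \<in> carrier ?B" "w \<in> carrier ?B" for z w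
    using hom_mult[OF h] that by (simp add: base_change_simps)
  have h0: "h \<zero>\<^bsub>?B\<^esub> = \<zero>\<^bsub>X\<^esub>"
    using ha[OF B.M.zero_closed B.M.zero_closed] hc[OF B.M.zero_closed]
    by (metis B.M.zero_closed B.M.l_zero X.add.l_cancel_one')
  have "h (s \<odot>\<^bsub>?B\<^esub> z) = s \<odot>\<^bsub>X\<^esub> h z" if s: "s \<in> carrier S" and z: "z \<in> carrier ?B" for s z
    using z
  proof (induction rule: base_change_induct)
    case zero
    then show ?case using s by (simp add: h0)
  next
    case (add x t z)
    then show ?case
      using s base_change_pure_rules(1)
      by (simp add: B.smult_r_distr X.smult_r_distr ha hc hp base_change_smult_pure
            ring_module_simps g_rules[unfolded restrict_scalars_simps] X.smult_assoc1)
  qed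
  then have "h \<in> mod_hom S ?B X" by (intro mod_homI hc ha)
  then show thesis
  proof (rule that)
    fix x assume "x \<in> carrier M"
    then show "h (base_change_unit R S lam M x) = g x"
      using g_rules(1) by (simp add: base_change_unit_def hp ring_module_simps)
  qed
qed

text \<open>
  Uniqueness in the adjunction: the elements \<open>x \<otimes> 1\<close> generate \<open>M \<otimes> S\<close> over \<open>S\<close>.
\<close>

lemma base_change_hom_eqI:
  assumes X: "module S X"
    and f: "f \<in> mod_hom S (base_change R S lam M) X" and g: "g \<in> mod_hom S (base_change R S lam M) X"
    and eq: "\<And>x. x \<in> carrier M \<Longrightarrow> f (base_change_unit R S lam M x) = g (base_change_unit R S lam M x)"
    and z: "z \<in> carrier (base_change R S lam M)"
  shows "f z = g z"
  using z
proof (induction rule: base_change_induct)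
  case zero
  show ?case using mod_hom_zero[OF base_change_module X f] mod_hom_zero[OF base_change_module X g] by simp
next
  case (add x s z)
  have u: "base_change_unit R S lam M x \<in> carrier (base_change R S lam M)"
    using mod_hom_closed[OF base_change_unit_hom add.hyps(1)] by simp
  show ?case
    using add u eq
    by (simp add: base_change_pure_eq_smult_unit mod_hom_add[OF f] mod_hom_add[OF g]
          mod_hom_smult[OF f] mod_hom_smult[OF g])
qed

end

text \<open>
  The second claim is naturality of the unit. By uniqueness it characterises \<open>\<sigma> \<otimes> 1\<close> among the
  \<open>S\<close>-linear maps.
\<close>

lemma base_change_map_hom:
  assumes P: "module R P" and Q: "module R Q" and \<sigma>: "\<sigma> \<in> mod_hom R P Q"
  shows "base_change_map R S lam Q \<sigma> \<in> mod_hom S (base_change R S lam P) (base_change R S lam Q)"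
    and "x \<in> carrier P \<Longrightarrow>
      base_change_map R S lam Q \<sigma> (base_change_unit R S lam P x) = base_change_unit R S lam Q (\<sigma> x)"
proof -
  let ?P = "base_change R S lam P" and ?Q = "base_change R S lam Q" and ?\<sigma> = "base_change_map R S lam Q \<sigma>"
  interpret P: module S ?P by (rule base_change_module[OF P])
  interpret Q: module S ?Q by (rule base_change_module[OF Q])
  have id: "(\<lambda>t. t) \<in> mod_hom R (ring_module S lam) (ring_module S lam)" by (rule mod_homI) auto
  have pure: "?\<sigma> (pure_tensor R P (ring_module S lam) x s) = pure_tensor R Q (ring_module S lam) (\<sigma> x) s"
    if "x \<in> carrier P" "s \<in> carrier S" for x s
    using tensor_map_pure_tensor[OF P extension_ring_module Q extension_ring_module \<sigma> id] that
    by (simp add: base_change_map_def ring_module_simps)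
  then show "?\<sigma> (base_change_unit R S lam P x) = base_change_unit R S lam Q (\<sigma> x)" if "x \<in> carrier P"
    using that by (simp add: base_change_unit_def)
  have hom: "?\<sigma> \<in> hom (tensor_group R P (ring_module S lam)) (tensor_group R Q (ring_module S lam))"
    unfolding base_change_map_def
    by (rule tensor_map_hom[OF P extension_ring_module Q extension_ring_module \<sigma> id])
  have cl: "?\<sigma> z \<in> carrier ?Q" if "z \<in> carrier ?P" for z
    using hom_in_carrier[OF hom] that by (simp add: base_change_simps[OF P] base_change_simps[OF Q])
  have add: "?\<sigma> (z \<oplus>\<^bsub>?P\<^esub> w) = ?\<sigma> z \<oplus>\<^bsub>?Q\<^esub> ?\<sigma> w" if "z \<in> carrier ?P" "w \<in> carrier ?P" for z w
    using hom_mult[OF hom] that by (simp add: base_change_simps[OF P] base_change_simps[OF Q])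
  have zero: "?\<sigma> \<zero>\<^bsub>?P\<^esub> = \<zero>\<^bsub>?Q\<^esub>"
    using add[OF P.M.zero_closed P.M.zero_closed] cl[OF P.M.zero_closed]
    by (metis P.M.zero_closed P.M.l_zero Q.add.l_cancel_one')
  have "?\<sigma> (s \<odot>\<^bsub>?P\<^esub> z) = s \<odot>\<^bsub>?Q\<^esub> ?\<sigma> z" if s: "s \<in> carrier S" and z: "z \<in> carrier ?P" for s z
    using z
  proof (induction rule: base_change_induct[OF P, consumes 1, case_names 1 2])
    case 1
    then show ?case using s by (simp add: zero)
  next
    case (2 x t z)
    then show ?case
      using s base_change_pure_rules(1)[OF P] base_change_pure_rules(1)[OF Q] mod_hom_closed[OF \<sigma>]
      by (simp add: P.smult_r_distr Q.smult_r_distr add cl pure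
            base_change_smult_pure[OF P] base_change_smult_pure[OF Q])
  qed
  then show "?\<sigma> \<in> mod_hom S ?P ?Q" by (intro mod_homI cl add)
qed

lemma base_change_unit_comp:
  assumes M: "module R M" and f: "f \<in> mod_hom S (base_change R S lam M) X"
  shows "(\<lambda>x. f (base_change_unit R S lam M x)) \<in> mod_hom R M (restrict_scalars lam X)"
  by (rule mod_hom_comp[OF base_change_unit_hom[OF M] mod_hom_restrict_scalars[OF f]])

text \<open>
  Extension of scalars is left adjoint to restriction, and restriction keeps epimorphisms. So a
  lifting problem for \<open>P \<otimes> S\<close> over \<open>S\<close> restricts to one for \<open>P\<close> over \<open>R\<close>, and the adjoint of a solution
  is a solution by uniqueness.
\<close>

lemma projective_base_change:
  fixes P :: "('a, 'p) module"
  assumes P: "projective R P"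
  shows "projective S (base_change R S lam P)"
proof -
  have PM: "module R P" using P by (simp add: projective_def)
  let ?P = "base_change R S lam P"
  show ?thesis
  proof (rule projectiveI_lift[OF base_change_module[OF PM]])
    fix M :: "('b, ('p \<times> 'b \<Rightarrow>\<^sub>0 int) set \<Rightarrow> 'b) module" and N :: "('b, ('p \<times> 'b \<Rightarrow>\<^sub>0 int) set) module" and f g
    assume M: "module S M" and N: "module S N" and f: "f \<in> mod_epi S M N" and g: "g \<in> mod_hom S ?P N"
    have fh: "f \<in> mod_hom S M N" using f by (simp add: mod_epi_def)
    have f': "f \<in> mod_epi R (restrict_scalars lam M) (restrict_scalars lam N)"
      using f mod_hom_restrict_scalars[OF fh] by (simp add: mod_epi_def)
    obtain k where k: "k \<in> mod_hom R P (restrict_scalars lam M)"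
      "\<And>x. x \<in> carrier P \<Longrightarrow> f (k x) = g (base_change_unit R S lam P x)"
      using projective_lift[OF P restrict_scalars_module[OF M] restrict_scalars_module[OF N] f'
          base_change_unit_comp[OF PM g]] by blast
    obtain h where h: "h \<in> mod_hom S ?P M"
      "\<And>x. x \<in> carrier P \<Longrightarrow> h (base_change_unit R S lam P x) = k x"
      using base_change_hom[OF PM M k(1)] by blast
    have "f (h z) = g z" if "z \<in> carrier ?P" for z
      by (rule base_change_hom_eqI[OF PM N mod_hom_comp[OF h(1) fh] g _ that]) (simp add: h(2) k(2))
    with h(1) show "\<exists>h\<in>mod_hom S ?P M. \<forall>z\<in>carrier ?P. f (h z) = g z" by blast
  qed
qed

section \<open>Both silting classes are detected by restriction of scalars\<close>

context
  fixes P :: "('a, 'p) module" and Q :: "('a, 'q) module" and \<sigma> :: "'p \<Rightarrow> 'q"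
  assumes P: "module R P" and Q: "module R Q" and \<sigma>: "\<sigma> \<in> mod_hom R P Q"
begin

text \<open>
  By adjunction and naturality, composition with \<open>\<sigma> \<otimes> 1\<close> on homomorphisms into \<open>X\<close> is composition
  with \<open>\<sigma>\<close> on homomorphisms into the restriction of \<open>X\<close>, so one is surjective exactly if the other is.
\<close>

lemma silting_class_base_change:
  "X \<in> silting_class S (base_change R S lam P) (base_change R S lam Q) (base_change_map R S lam Q \<sigma>) \<longleftrightarrow>
    module S X \<and> restrict_scalars lam X \<in> silting_class R P Q \<sigma>"
    (is "X \<in> silting_class S ?P ?Q ?\<sigma> \<longleftrightarrow> _")
proof (intro iffI conjI; (elim conjE)?)
  note \<sigma>_unit = base_change_map_hom(2)[OF P Q \<sigma>]
  assume X_in: "X \<in> silting_class S ?P ?Q ?\<sigma>"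
  then show X: "module S X" by (simp add: silting_class_def)
  have "\<exists>h\<in>mod_hom R Q (restrict_scalars lam X). \<forall>x\<in>carrier P. h (\<sigma> x) = g x"
    if g: "g \<in> mod_hom R P (restrict_scalars lam X)" for g
  proof -
    obtain g' where g': "g' \<in> mod_hom S ?P X"
      "\<And>x. x \<in> carrier P \<Longrightarrow> g' (base_change_unit R S lam P x) = g x"
      using base_change_hom[OF P X g] by blast
    then obtain h where h: "h \<in> mod_hom S ?Q X" "\<And>z. z \<in> carrier ?P \<Longrightarrow> h (?\<sigma> z) = g' z"
      using X_in by (auto simp: silting_class_def)
    have "h (base_change_unit R S lam Q (\<sigma> x)) = g x" if x: "x \<in> carrier P" for x
      using h(2)[of "base_change_unit R S lam P x"] mod_hom_closed[OF base_change_unit_hom[OF P] x]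
      by (simp add: x g'(2) \<sigma>_unit)
    then show ?thesis by (intro bexI[OF _ base_change_unit_comp[OF Q h(1)]] ballI)
  qed
  with restrict_scalars_module[OF X] show "restrict_scalars lam X \<in> silting_class R P Q \<sigma>"
    by (simp add: silting_class_def)
next
  note \<sigma>_unit = base_change_map_hom(2)[OF P Q \<sigma>]
  assume X: "module S X" and X_in: "restrict_scalars lam X \<in> silting_class R P Q \<sigma>"
  have "\<exists>h\<in>mod_hom S ?Q X. \<forall>z\<in>carrier ?P. h (?\<sigma> z) = g z" if g: "g \<in> mod_hom S ?P X" for g
  proof -
    have "\<forall>g\<in>mod_hom R P (restrict_scalars lam X).
        \<exists>k\<in>mod_hom R Q (restrict_scalars lam X). \<forall>x\<in>carrier P. k (\<sigma> x) = g x"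
      using X_in by (simp add: silting_class_def)
    from bspec[OF this base_change_unit_comp[OF P g]]
    obtain k where k: "k \<in> mod_hom R Q (restrict_scalars lam X)"
      "\<forall>x\<in>carrier P. k (\<sigma> x) = g (base_change_unit R S lam P x)"
      by (rule bexE)
    obtain h where h: "h \<in> mod_hom S ?Q X"
      "\<And>y. y \<in> carrier Q \<Longrightarrow> h (base_change_unit R S lam Q y) = k y"
      using base_change_hom[OF Q X k(1)] by blast
    have "h (?\<sigma> z) = g z" if "z \<in> carrier ?P" for z
      by (rule base_change_hom_eqI[OF P X mod_hom_comp[OF base_change_map_hom(1)[OF P Q \<sigma>] h(1)] g _ that])
         (simp add: \<sigma>_unit h(2) bspec[OF k(2)] mod_hom_closed[OF \<sigma>])
    with h(1) show ?thesis by blast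
  qed
  with X show "X \<in> silting_class S ?P ?Q ?\<sigma>" by (simp add: silting_class_def)
qed

text \<open>
  By adjunction, homomorphisms \<open>h\<close> from \<open>Q \<otimes> S\<close> to \<open>X\<close> that vanish on the image of \<open>\<sigma> \<otimes> 1\<close> correspond to
  homomorphisms \<open>g\<close> from \<open>Q\<close> to the restriction of \<open>X\<close> that vanish on the image of \<open>\<sigma>\<close>. The values of
  all such \<open>h\<close> lie in the \<open>S\<close>-span of the values of all such \<open>g\<close>. Since \<open>s \<cdot> g\<close> is again such a
  homomorphism, the \<open>S\<close>-span is no larger than the additive span, so the two families generate the
  same subgroup of \<open>X\<close>.
\<close>

lemma Gen_Coker_base_change:
  "X \<in> Gen S (Coker (base_change R S lam P) (base_change R S lam Q) (base_change_map R S lam Q \<sigma>)) \<longleftrightarrow>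
    module S X \<and> restrict_scalars lam X \<in> Gen R (Coker P Q \<sigma>)"
    (is "X \<in> Gen S (Coker ?P ?Q ?\<sigma>) \<longleftrightarrow> _")
proof (cases "module S X")
  case False
  then show ?thesis by (simp add: Gen_def)
next
  case X: True
  interpret X: module S X by (rule X)
  note \<sigma>_hom = base_change_map_hom(1)[OF P Q \<sigma>] and \<sigma>_unit = base_change_map_hom(2)[OF P Q \<sigma>]
  let ?A = "{h z | h z. h \<in> mod_hom S ?Q X \<and> (\<forall>w\<in>carrier ?P. h (?\<sigma> w) = \<zero>\<^bsub>X\<^esub>) \<and> z \<in> carrier ?Q}"
  let ?B = "{g y | g y. g \<in> mod_hom R Q (restrict_scalars lam X) \<and>
    (\<forall>x\<in>carrier P. g (\<sigma> x) = \<zero>\<^bsub>X\<^esub>) \<and> y \<in> carrier Q}"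
  have "?B \<subseteq> ?A"
  proof
    fix b assume "b \<in> ?B"
    then obtain g y where g: "g \<in> mod_hom R Q (restrict_scalars lam X)"
      "\<And>x. x \<in> carrier P \<Longrightarrow> g (\<sigma> x) = \<zero>\<^bsub>X\<^esub>" and y: "y \<in> carrier Q" "b = g y" by blast
    obtain h where h: "h \<in> mod_hom S ?Q X"
      "\<And>y. y \<in> carrier Q \<Longrightarrow> h (base_change_unit R S lam Q y) = g y"
      using base_change_hom[OF Q X g(1)] by blast
    have zero: "(\<lambda>z. \<zero>\<^bsub>X\<^esub>) \<in> mod_hom S ?P X" by (rule mod_homI) auto
    have "h (?\<sigma> w) = \<zero>\<^bsub>X\<^esub>" if "w \<in> carrier ?P" for w
      by (rule base_change_hom_eqI[OF P X mod_hom_comp[OF \<sigma>_hom h(1)] zero _ that])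
         (simp add: \<sigma>_unit h(2) g(2) mod_hom_closed[OF \<sigma>])
    then show "b \<in> ?A"
      using h y mod_hom_closed[OF base_change_unit_hom[OF Q] y(1)]
      by (intro CollectI exI[of _ h] exI[of _ "base_change_unit R S lam Q y"]) simp
  qed
  then have BA: "add_closure X ?B \<subseteq> add_closure X ?A" by (rule add_closure_mono)
  (* Adding h z to an arbitrary element x of the closure makes the sum decomposition of z directly
     usable: each pure tensor in z contributes one generator. *)
  have A_closure: "h z \<oplus>\<^bsub>X\<^esub> x \<in> add_closure X ?B"
    if h: "h \<in> mod_hom S ?Q X" "\<And>w. w \<in> carrier ?P \<Longrightarrow> h (?\<sigma> w) = \<zero>\<^bsub>X\<^esub>"
      and z: "z \<in> carrier ?Q" and x: "x \<in> add_closure X ?B" "x \<in> carrier X" for h z x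
    using z x
  proof (induction arbitrary: x rule: base_change_induct[OF Q, consumes 1, case_names 1 2])
    case 1
    then show ?case using mod_hom_zero[OF base_change_module[OF Q] X h(1)] by simp
  next
    case (2 y s z)
    (* h (y \<otimes> s) is the value at y of the homomorphism s \<cdot> h(_ \<otimes> 1). *)
    let ?g = "\<lambda>y. s \<odot>\<^bsub>X\<^esub> h (base_change_unit R S lam Q y)"
    have u: "base_change_unit R S lam Q y \<in> carrier ?Q" if "y \<in> carrier Q" for y
      using mod_hom_closed[OF base_change_unit_hom[OF Q] that] by simp
    have "?g \<in> mod_hom R Q (restrict_scalars lam X)"
      by (rule mod_hom_restrict_scalars_smult[OF X base_change_unit_comp[OF Q h(1)] 2(2)])
    moreover have "?g (\<sigma> x) = \<zero>\<^bsub>X\<^esub>" if x: "x \<in> carrier P" for x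
      using h(2)[of "base_change_unit R S lam P x"] mod_hom_closed[OF base_change_unit_hom[OF P] x] 2(2)
      by (simp add: \<sigma>_unit x)
    ultimately have gB: "?g y \<in> ?B" using 2(1) by (intro CollectI exI[of _ ?g] exI[of _ y]) simp
    have pt: "pure_tensor R Q (ring_module S lam) y s \<in> carrier ?Q"
      using base_change_pure_rules(1)[OF Q] 2 by simp
    have "h (pure_tensor R Q (ring_module S lam) y s) = ?g y"
      using 2 u mod_hom_smult[OF h(1)] by (simp add: base_change_pure_eq_smult_unit[OF Q])
    then have "h (pure_tensor R Q (ring_module S lam) y s \<oplus>\<^bsub>?Q\<^esub> z) \<oplus>\<^bsub>X\<^esub> x = ?g y \<oplus>\<^bsub>X\<^esub> (h z \<oplus>\<^bsub>X\<^esub> x)"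
      using 2 u mod_hom_add[OF h(1) pt 2(3)] mod_hom_closed[OF h(1)] by (simp add: X.M.a_assoc)
    then show ?case using add_closure.add[OF gB 2(4)[OF 2(5,6)]] by simp
  qed
  have AB: "x \<in> add_closure X ?B \<and> x \<in> carrier X" if "x \<in> add_closure X ?A" for x
    using that
  proof induction
    case zero
    then show ?case by (simp add: add_closure.zero)
  next
    case (add a x)
    then obtain h z where h: "h \<in> mod_hom S ?Q X" "\<And>w. w \<in> carrier ?P \<Longrightarrow> h (?\<sigma> w) = \<zero>\<^bsub>X\<^esub>"
      and z: "z \<in> carrier ?Q" "a = h z" by blast
    then show ?case using A_closure[OF h z(1)] add.IH mod_hom_closed[OF h(1) z(1)] by simp
  qed
  from AB have "add_closure X ?A \<subseteq> add_closure X ?B" by (intro subsetI) (rule conjunct1)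
  with BA have "add_closure X ?A = add_closure X ?B" by (rule equalityI[rotated])
  then show ?thesis
    using Gen_Coker_iff[OF base_change_module[OF P] base_change_module[OF Q] \<sigma>_hom, of X]
      Gen_Coker_iff[OF P Q \<sigma>, of "restrict_scalars lam X"] X restrict_scalars_module[OF X]
    by (simp add: add_closure_restrict_scalars)
qed

end

end

theorem theorem2p7:
  fixes R :: "('a, 'k) ring_scheme" and S :: "('b, 'l) ring_scheme" and lam :: "'a \<Rightarrow> 'b"
    and P :: "('a, 'p) module" and Q :: "('a, 'q) module" and \<sigma> :: "'p \<Rightarrow> 'q"
  assumes "cring R" and "cring S" and "lam \<in> ring_hom R S"
    and "two_term_silting TYPE('x) R P Q \<sigma>"
  shows "two_term_silting TYPE('x) S (base_change R S lam P) (base_change R S lam Q)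
           (base_change_map R S lam Q \<sigma>)"
proof -
  note lam = assms(1-3)
  have P: "projective R P" "module R P" and Q: "projective R Q" "module R Q"
    and \<sigma>: "\<sigma> \<in> mod_hom R P Q"
    and silting: "(silting_class R P Q \<sigma> :: ('a, 'x) module set) = Gen R (Coker P Q \<sigma>)"
    using assms(4) by (auto simp: two_term_silting_def projective_def)
  show ?thesis
    unfolding two_term_silting_def
  proof (intro conjI)
    show "projective S (base_change R S lam P)" "projective S (base_change R S lam Q)"
      by (rule projective_base_change[OF lam P(1)], rule projective_base_change[OF lam Q(1)])
    show "base_change_map R S lam Q \<sigma> \<in> mod_hom S (base_change R S lam P) (base_change R S lam Q)"
      by (rule base_change_map_hom(1)[OF lam P(2) Q(2) \<sigma>])
    show "(silting_class S (base_change R S lam P) (base_change R S lam Q) (base_change_map R S lam Q \<sigma>)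
        :: ('b, 'x) module set) =
      Gen S (Coker (base_change R S lam P) (base_change R S lam Q) (base_change_map R S lam Q \<sigma>))"
      by (intro Set.set_eqI)
         (simp only: silting_class_base_change[OF lam P(2) Q(2) \<sigma>]
            Gen_Coker_base_change[OF lam P(2) Q(2) \<sigma>] silting)
  qed
qed

end
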